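(* The Orthogonal Vectors problem $\mathsf{OV}$ on $n+n$ vectors in $\{0,1\}^d$ can be solved by a deterministic algorithm in time $\tilde O(n\cdot 1.155^d)$.
   Context: In $\mathsf{OV}$ one is given vectors $u_1,\dots,u_n,v_1,\dots,v_n\in\{0,1\}^d$ and must decide whether there exist $i,j\in[n]$ with $\langle u_i,v_j\rangle=0$, the inner product being over $\mathbb{Z}$. $\tilde O$ hides factors polynomial in $d$ and $\log n$. *)

theory Defs
  imports Complex_Main "HOL-Library.Log_Nat" "Jordan_Normal_Form.Matrix"
begin

text \<open>
  Model of computation: random access machine over the natural numbers under the logarithmic
  cost criterion. A program is a fixed while-program, independent of the input, using finitely
  many registers (named by constants in the program text) and an unbounded random access memory.
  Every elementary operation is charged one plus the bit lengths of the addresses and values it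
  handles, so that long words give no advantage; this model agrees with the word RAM and with the
  logarithmic-cost jump-based RAM up to the polynomial factors in \<open>d\<close> and \<open>log n\<close> that are
  ignored below.
\<close>

datatype operand = Imm nat | Reg nat

datatype arith = Add | Sub | Mul | Div

datatype test = Eq operand operand | Less operand operand

datatype com =
    Skip
  | Move nat operand
  | Arith nat arith operand operand
  | Load nat operand
  | Store operand operand
  | Seq com com
  | If test com com
  | While test com

record state =
  regs :: "nat \<Rightarrow> nat"
  mem :: "nat \<Rightarrow> nat"

fun val :: "operand \<Rightarrow> state \<Rightarrow> nat" where
  "val (Imm c) s = c"
| "val (Reg r) s = regs s r"

text \<open>Subtraction is truncated at zero, and division by zero yields zero.\<close>

fun arith_val :: "arith \<Rightarrow> nat \<Rightarrow> nat \<Rightarrow> nat" where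
  "arith_val Add a b = a + b"
| "arith_val Sub a b = a - b"
| "arith_val Mul a b = a * b"
| "arith_val Div a b = a div b"

fun test_val :: "test \<Rightarrow> state \<Rightarrow> bool" where
  "test_val (Eq x y) s \<longleftrightarrow> val x s = val y s"
| "test_val (Less x y) s \<longleftrightarrow> val x s < val y s"

definition set_reg :: "nat \<Rightarrow> nat \<Rightarrow> state \<Rightarrow> state" where
  "set_reg r a s = s\<lparr>regs := (regs s)(r := a)\<rparr>"

definition set_mem :: "nat \<Rightarrow> nat \<Rightarrow> state \<Rightarrow> state" where
  "set_mem p a s = s\<lparr>mem := (mem s)(p := a)\<rparr>"

text \<open>\<open>floorlog 2 a\<close> is the number of binary digits of \<open>a\<close>, with value \<open>0\<close> at \<open>a = 0\<close>.\<close>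

definition cost1 :: "nat \<Rightarrow> nat" where
  "cost1 a = 1 + floorlog 2 a"

definition cost2 :: "nat \<Rightarrow> nat \<Rightarrow> nat" where
  "cost2 a b = 1 + floorlog 2 a + floorlog 2 b"

fun test_cost :: "test \<Rightarrow> state \<Rightarrow> nat" where
  "test_cost (Eq x y) s = cost2 (val x s) (val y s)"
| "test_cost (Less x y) s = cost2 (val x s) (val y s)"

text \<open>\<open>exec c s t s'\<close>: started in \<open>s\<close>, the program \<open>c\<close> halts in \<open>s'\<close> after time exactly \<open>t\<close>.\<close>

inductive exec :: "com \<Rightarrow> state \<Rightarrow> nat \<Rightarrow> state \<Rightarrow> bool" where
  Skip: "exec Skip s 1 s"
| Move: "exec (Move r x) s (cost1 (val x s)) (set_reg r (val x s) s)"
| Arith: "exec (Arith r f x y) s (cost2 (val x s) (val y s))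
            (set_reg r (arith_val f (val x s) (val y s)) s)"
| Load: "exec (Load r x) s (cost2 (val x s) (mem s (val x s)))
            (set_reg r (mem s (val x s)) s)"
| Store: "exec (Store x y) s (cost2 (val x s) (val y s)) (set_mem (val x s) (val y s) s)"
| Seq: "exec c1 s t1 s1 \<Longrightarrow> exec c2 s1 t2 s2 \<Longrightarrow> exec (Seq c1 c2) s (t1 + t2) s2"
| IfTrue: "test_val b s \<Longrightarrow> exec c1 s t s1 \<Longrightarrow> exec (If b c1 c2) s (test_cost b s + t) s1"
| IfFalse: "\<not> test_val b s \<Longrightarrow> exec c2 s t s1 \<Longrightarrow> exec (If b c1 c2) s (test_cost b s + t) s1"
| WhileFalse: "\<not> test_val b s \<Longrightarrow> exec (While b c) s (test_cost b s) s"
| WhileTrue: "test_val b s \<Longrightarrow> exec c s t1 s1 \<Longrightarrow> exec (While b c) s1 t2 s2 \<Longrightarrow>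
            exec (While b c) s (test_cost b s + t1 + t2) s2"

inductive_cases exec_SkipE: "exec Skip s t s'"
inductive_cases exec_MoveE: "exec (Move r x) s t s'"
inductive_cases exec_ArithE: "exec (Arith r f x y) s t s'"
inductive_cases exec_LoadE: "exec (Load r x) s t s'"
inductive_cases exec_StoreE: "exec (Store x y) s t s'"
inductive_cases exec_SeqE: "exec (Seq c1 c2) s t s'"
inductive_cases exec_IfE: "exec (If b c1 c2) s t s'"
inductive_cases exec_WhileE: "exec (While b c) s t s'"

lemma exec_deterministic:
  "exec c s t s' \<Longrightarrow> exec c s t' s'' \<Longrightarrow> t' = t \<and> s'' = s'"
proof (induction arbitrary: t' s'' rule: exec.induct)
  case (Skip s)
  then show ?case by (rule exec_SkipE) simp
next
  case (Move r x s)
  then show ?case by (rule exec_MoveE) simp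
next
  case (Arith r f x y s)
  then show ?case by (rule exec_ArithE) simp
next
  case (Load r x s)
  then show ?case by (rule exec_LoadE) simp
next
  case (Store x y s)
  then show ?case by (rule exec_StoreE) simp
next
  case (Seq c1 s t1 s1 c2 t2 s2)
  from Seq.prems obtain u1 r1 u2
    where "exec c1 s u1 r1" "exec c2 r1 u2 s''" "t' = u1 + u2"
    by (rule exec_SeqE)
  with Seq.IH show ?case by blast
next
  case (IfTrue b s c1 t s1 c2)
  from IfTrue.prems IfTrue.hyps(1) obtain u where "exec c1 s u s''" "t' = test_cost b s + u"
    by (metis exec_IfE)
  with IfTrue.IH show ?case by blast
next
  case (IfFalse b s c2 t s1 c1)
  from IfFalse.prems IfFalse.hyps(1) obtain u where "exec c2 s u s''" "t' = test_cost b s + u"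
    by (metis exec_IfE)
  with IfFalse.IH show ?case by blast
next
  case (WhileFalse b s c)
  from WhileFalse.prems WhileFalse.hyps show ?case by (metis exec_WhileE)
next
  case (WhileTrue b s c t1 s1 t2 s2)
  from WhileTrue.prems WhileTrue.hyps(1) obtain u1 r1 u2
    where "exec c s u1 r1" "exec (While b c) r1 u2 s''" "t' = test_cost b s + u1 + u2"
    by (metis exec_WhileE)
  with WhileTrue.IH show ?case by blast
qed

text \<open>
  The vectors \<open>u\<^sub>1,\<dots>,u\<^sub>n\<close> and \<open>v\<^sub>1,\<dots>,v\<^sub>n\<close> are \<open>u i\<close> and \<open>v i\<close> for \<open>i < n\<close>; values at other
  indices are irrelevant.
\<close>

definition ov_instance :: "nat \<Rightarrow> nat \<Rightarrow> (nat \<Rightarrow> int vec) \<Rightarrow> (nat \<Rightarrow> int vec) \<Rightarrow> bool" where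
  "ov_instance n d u v \<longleftrightarrow>
     (\<forall>i<n. u i \<in> carrier_vec d \<and> v i \<in> carrier_vec d \<and>
        (\<forall>k<d. u i $ k \<in> {0, 1} \<and> v i $ k \<in> {0, 1}))"

definition has_orthogonal_pair :: "nat \<Rightarrow> (nat \<Rightarrow> int vec) \<Rightarrow> (nat \<Rightarrow> int vec) \<Rightarrow> bool" where
  "has_orthogonal_pair n u v \<longleftrightarrow> (\<exists>i<n. \<exists>j<n. u i \<bullet> v j = 0)"

text \<open>
  Initially \<open>n\<close> and \<open>d\<close> are in registers \<open>0\<close> and \<open>1\<close>, and the entries of
  \<open>u 0, \<dots>, u (n - 1), v 0, \<dots>, v (n - 1)\<close> are in the memory cells \<open>0, \<dots>, 2 n d - 1\<close>, one entry
  per cell. All other registers and cells contain zero.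
\<close>

definition ov_input :: "nat \<Rightarrow> nat \<Rightarrow> (nat \<Rightarrow> int vec) \<Rightarrow> (nat \<Rightarrow> int vec) \<Rightarrow> state" where
  "ov_input n d u v =
     \<lparr>regs = (\<lambda>r. if r = 0 then n else if r = 1 then d else 0),
      mem = (\<lambda>a. if a < n * d then nat (u (a div d) $ (a mod d))
                 else if a < 2 * n * d then nat (v ((a - n * d) div d) $ ((a - n * d) mod d))
                 else 0)\<rparr>"

text \<open>The answer is returned in register \<open>0\<close>.\<close>

definition solves_OV_in_time :: "com \<Rightarrow> (nat \<Rightarrow> nat \<Rightarrow> real) \<Rightarrow> bool" where
  "solves_OV_in_time c T \<longleftrightarrow>
     (\<forall>n d u v. n \<ge> 1 \<and> ov_instance n d u v \<longrightarrow>
        (\<exists>t s. exec c (ov_input n d u v) t s \<and>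
           regs s 0 = (if has_orthogonal_pair n u v then 1 else 0) \<and>
           real t \<le> T n d))"

end

theory Submission
  imports Defs "HOL-Library.Nat_Bijection"
begin

text \<open>
  Fix a block length \<open>B\<close>. It suffices to assign to every \<open>U \<subseteq> {..<B}\<close> two sets of keys \<open>A U\<close> and
  \<open>A' U\<close>, each of size at most \<open>1.155 ^ B\<close>, such that \<open>A U\<close> meets \<open>A' V\<close> iff \<open>U\<close> and \<open>V\<close> are
  disjoint: cut the coordinates into blocks, let the keys of a vector be the sequences that choose
  one key per block, mark the keys of all \<open>u i\<close> in memory and look up the keys of all \<open>v j\<close>. As
  \<open>B\<close> is constant, the tables can be part of the program.

  Such keys come from separating families. If \<open>U\<close> and \<open>V\<close> have sizes \<open>a\<close> and \<open>b\<close>, put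
  \<open>z = B - a - b\<close> and take random sets \<open>S\<close> of size \<open>a + x\<close>, where \<open>S\<close> is a key of \<open>U\<close> if \<open>U \<subseteq> S\<close>
  and a key of \<open>V\<close> if \<open>S \<inter> V = {}\<close>. Covering all disjoint pairs needs about
  \<open>f = (b + z choose x) / (z choose x)\<close> keys for \<open>U\<close> and
  \<open>g = (a + z choose z - x) / (z choose x)\<close> keys for \<open>V\<close>, up to polynomial factors. Choosing \<open>x\<close>
  with \<open>f\<close> close to \<open>g\<close> makes both at most \<open>(2 / sqrt 3) ^ B\<close> up to such factors; the worst case
  is \<open>a = b = z = B / 3\<close>.
\<close>

section \<open>The exponent\<close>

text \<open>The obstacle is that the \<open>x\<close> balancing \<open>f\<close> and
  \<open>g\<close> has no closed form and need not be an integer. What is bounded instead, for every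
  \<open>x\<close> strictly between 0 and \<open>z\<close>, is the weighted product
  \<open>f ^ (z - x) * g ^ x\<close>: if it is at most \<open>K ^ z\<close>, then the smaller of
  \<open>f\<close> and \<open>g\<close> is at most \<open>K\<close>, and at the place where their
  order changes both are small up to a polynomial factor. In this product each binomial is estimated
  with a probability of free choice; suitable ones let \<open>a\<close> and \<open>b\<close> enter
  only through \<open>B\<close> and leave an inequality in the ratios z/x and z/(z - x). For the
  rate ln (2 / sqrt 3) it is an equality when both are 2, so the numerical estimates there have to
  be sharp. Moreover, the number of keys must be small for every single set, not on average, so the
  sampling has to control exponential moments. Finally, the table of marks spans
  \<open>R ^ k\<close> cells, which may be far more than the time bound allows to touch. This is
  harmless: memory is zero from the start, and an address costs only its bit length.\<close>

lemma nonneg_if_deriv_nonneg: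
  fixes f f' :: "real \<Rightarrow> real"
  assumes "\<And>x. 0 \<le> x \<Longrightarrow> (f has_real_derivative f' x) (at x)"
    and "\<And>x. 0 \<le> x \<Longrightarrow> 0 \<le> f' x" and "0 \<le> f 0" and "0 \<le> x"
  shows "0 \<le> f x"
proof -
  have "f 0 \<le> f x"
    by (rule DERIV_nonneg_imp_nondecreasing[OF \<open>0 \<le> x\<close>]) (use assms in blast)
  then show ?thesis using assms(3) by simp
qed

lemma exp_minus_lower_cubic:
  fixes x :: real
  assumes "0 \<le> x"
  shows "1 - x + x^2/2 - x^3/6 \<le> exp (-x)"
proof -
  have 1: "0 \<le> exp (-y) - 1 + y" if "0 \<le> y" for y :: real
    using exp_ge_add_one_self[of "-y"] by simp
  have 2: "exp (-y) \<le> 1 - y + y^2/2" if "0 \<le> y" for y :: real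
  proof -
    have "0 \<le> 1 - y + y^2/2 - exp (-y)"
      by (rule nonneg_if_deriv_nonneg[where f = "\<lambda>y. 1 - y + y^2/2 - exp (-y)"
            and f' = "\<lambda>y. exp (-y) - 1 + y"])
         (auto intro!: derivative_eq_intros 1 that)
    then show ?thesis by simp
  qed
  have "0 \<le> exp (-x) - (1 - x + x^2/2 - x^3/6)"
    by (rule nonneg_if_deriv_nonneg[where f = "\<lambda>x. exp (-x) - (1 - x + x^2/2 - x^3/6)"
          and f' = "\<lambda>y. 1 - y + y^2/2 - exp (-y)"])
       (auto intro!: derivative_eq_intros 2 assms)
  then show ?thesis by simp
qed

lemma exp_diff_lower_cubic:
  fixes x :: real
  assumes "0 \<le> x"
  shows "2 * x + x^3/3 \<le> exp x - exp (-x)"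
proof -
  have 0: "2 \<le> exp y + exp (-y)" for y :: real
    using cosh_real_ge_1[of y] by (simp add: cosh_def)
  have 1: "2*y \<le> exp y - exp (-y)" if "0 \<le> y" for y :: real
  proof -
    have "0 \<le> exp y - exp (-y) - 2*y"
      by (rule nonneg_if_deriv_nonneg[where f = "\<lambda>y. exp y - exp (-y) - 2*y"
            and f' = "\<lambda>y. exp y + exp (-y) - 2"])
         (auto intro!: derivative_eq_intros 0 that)
    then show ?thesis by simp
  qed
  have 2: "y^2 \<le> exp y + exp (-y) - 2" if "0 \<le> y" for y :: real
  proof -
    have "0 \<le> exp y + exp (-y) - 2 - y^2"
      by (rule nonneg_if_deriv_nonneg[where f = "\<lambda>y. exp y + exp (-y) - 2 - y^2"
            and f' = "\<lambda>y. exp y - exp (-y) - 2*y"])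
         (auto intro!: derivative_eq_intros 1 that)
    then show ?thesis by simp
  qed
  have "0 \<le> exp x - exp (-x) - (2 * x + x^3/3)"
    by (rule nonneg_if_deriv_nonneg[where f = "\<lambda>x. exp x - exp (-x) - (2 * x + x^3/3)"
          and f' = "\<lambda>y. exp y + exp (-y) - 2 - y^2"])
       (auto intro!: derivative_eq_intros 2 assms)
  then show ?thesis by simp
qed

text \<open>\<open>1 - exp (-t)\<close> is \<open>2 * exp (-t/2) * sinh (t/2)\<close>, and sinh is
  cut after its cubic term. With \<open>exp (-t/2)\<close> split off, the exponentials of two such
  bounds combine to one that depends only on the sum of the arguments.\<close>

lemma one_minus_exp_lower:
  fixes t :: real
  assumes "0 \<le> t"
  shows "t * exp (-t/2) * (1 + t^2/24) \<le> 1 - exp (-t)"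
proof -
  have "t * (1 + t^2/24) \<le> exp (t/2) - exp (-t/2)"
    using exp_diff_lower_cubic[of "t/2"] assms
    by (simp add: algebra_simps power2_eq_square power3_eq_cube)
  then have "t * (1 + t^2/24) * exp (-t/2) \<le> (exp (t/2) - exp (-t/2)) * exp (-t/2)"
    by (intro mult_right_mono) auto
  also have "\<dots> = 1 - exp (-t)"
    by (simp add: left_diff_distrib flip: exp_add)
  finally show ?thesis by (simp add: algebra_simps)
qed

text \<open>Any number strictly between \<open>ln (2 / sqrt 3)\<close> and \<open>ln 1.155\<close> could serve here.\<close>

definition rate :: real where "rate = 2881 / 20000"

lemma rate_pos: "0 < rate" by (simp add: rate_def)

lemma exp_rate_less: "exp rate < 1.155"
proof -
  have "1000/1155 < 1 - rate + rate^2/2 - rate^3/6"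
    by (simp add: rate_def power2_eq_square power3_eq_cube)
  also have "\<dots> \<le> exp (-rate)"
    using exp_minus_lower_cubic[of rate] rate_pos by simp
  finally show ?thesis by (simp add: exp_minus field_simps)
qed

text \<open>The equation says 1/\<mu> + 1/\<nu> = 1. At the rate ln (2 / sqrt 3) one has exp (-2 *
  rate) = 3/4, so that 1/16 would be attained at \<mu> = \<nu> = 2. The actual \<open>rate\<close>
  is larger by only about 0.0002; crude bounds therefore do for large \<nu>, but not near 2.\<close>

lemma exp_rate_product:
  fixes \<mu> \<nu> :: real
  assumes le: "\<mu> \<le> \<nu>" and \<mu>: "1 < \<mu>" and eq: "\<mu> * \<nu> = \<mu> + \<nu>"
  shows "1/16 \<le> (1 - exp (-(rate * \<mu>))) * (1 - exp (-(rate * \<nu>)))"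
proof (cases "5 \<le> \<nu>")
  case True
  have exp_le: "exp (-x) \<le> 1 / (1 + x + x^2/2)" if "0 \<le> x" for x :: real
    using exp_lower_Taylor_quadratic[OF that] that
    by (simp add: exp_minus field_simps add_pos_nonneg)
  have "13/100 \<le> 1 - exp (-rate)"
    using exp_le[of rate] by (simp add: rate_def power2_eq_square)
  also have "\<dots> \<le> 1 - exp (-(rate * \<mu>))" using \<mu> rate_pos by simp
  finally have 1: "13/100 \<le> 1 - exp (-(rate * \<mu>))" .
  have "49/100 \<le> 1 - exp (-(rate * 5))"
    using exp_le[of "rate * 5"] by (simp add: rate_def power2_eq_square)
  also have "\<dots> \<le> 1 - exp (-(rate * \<nu>))" using True rate_pos by simp
  finally have 2: "49/100 \<le> 1 - exp (-(rate * \<nu>))" .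
  have "13/100 * (49/100) \<le> (1 - exp (-(rate * \<mu>))) * (1 - exp (-(rate * \<nu>)))"
    using 1 2 \<mu> rate_pos by (intro mult_mono) auto
  then show ?thesis by simp
next
  case False
  \<comment> \<open>Sum and product of \<mu> and \<nu> coincide, so the main term of the product of
    the lower bounds is \<open>rate^2 * M * exp (-(rate * M / 2))\<close>. It increases while
    \<open>M\<close> runs from 4 to 7, hence its value at \<open>M = 4\<close> is the critical
    one.\<close>
  define M where "M = \<mu> + \<nu>"
  have \<nu>: "1 < \<nu>" using le \<mu> by simp
  have "M * 4 \<le> M * M"
    using sum_squares_ge_zero[of "\<mu> - \<nu>" 0] eq unfolding M_def
    by (simp add: algebra_simps)
  then have M4: "4 \<le> M"
    using \<mu> \<nu> by (subst (asm) mult_le_cancel_left_pos) (auto simp: M_def)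
  have "\<mu> \<le> 2"
  proof (rule ccontr)
    assume "\<not> \<mu> \<le> 2"
    then have "0 < (\<mu> - 2) * \<nu>" using \<nu> by simp
    then show False using eq le by (simp add: algebra_simps)
  qed
  then have M7: "M \<le> 7" using False M_def by simp
  have exp_le: "exp (2 * rate * h) \<le> 1 + h" if "0 \<le> h" "h \<le> 1" for h :: real
  proof -
    have "exp (2 * rate * h) \<le> 1 + (2 * rate * h) + (2 * rate * h)^2"
      using that by (intro exp_bound) (auto simp: rate_def)
    also have "(2 * rate * h)^2 \<le> h * (1/2)"
    proof -
      have "(2 * rate)^2 * (h * h) \<le> (1/2) * (h * 1)"
        using that by (intro mult_mono) (auto simp: rate_def power2_eq_square)
      then show ?thesis by (simp add: power2_eq_square algebra_simps)
    qed
    also have "1 + 2 * rate * h + h * (1/2) \<le> 1 + h" using that by (simp add: rate_def)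
    finally show ?thesis by simp
  qed
  have "4 * exp (2 * rate * ((M-4)/4)) \<le> M"
    using exp_le[of "(M-4)/4"] M4 M7 by (simp add: field_simps)
  then have "4 * exp (2 * rate * ((M-4)/4)) * exp (-(rate * M / 2)) \<le> M * exp (-(rate * M / 2))"
    by (intro mult_right_mono) auto
  moreover have "2 * rate * ((M-4)/4) + -(rate * M / 2) = - (2 * rate)"
    by (simp add: field_simps)
  ultimately have ME: "4 * exp (-(2 * rate)) \<le> M * exp (-(rate * M / 2))"
    by (simp flip: exp_add add: mult.assoc)
  \<comment> \<open>The main term at \<open>M = 4\<close> is about 0.0622 and just misses 1/16; the
    factor with \<open>8 / 24\<close>, coming from the cubic corrections, makes up for it.\<close>
  have "1/16 \<le> rate^2 * (4 * (1 - 2*rate + (2*rate)^2/2 - (2*rate)^3/6)) * (1 + rate^2 * 8 / 24)"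
    by (simp add: rate_def power2_eq_square power3_eq_cube)
  also have "\<dots> \<le> rate^2 * (4 * exp (-(2*rate))) * (1 + rate^2 * 8 / 24)"
    using exp_minus_lower_cubic[of "2*rate"] rate_pos
    by (intro mult_right_mono mult_left_mono) auto
  also have "\<dots> \<le> rate^2 * (M * exp (-(rate * M / 2))) * (1 + rate^2 * 8 / 24)"
    using ME by (intro mult_right_mono mult_left_mono) auto
  also have "\<dots> \<le> rate^2 * (M * exp (-(rate * M / 2)))
       * ((1 + (rate*\<mu>)^2/24) * (1 + (rate*\<nu>)^2/24))"
  proof (intro mult_left_mono)
    have "8 \<le> M * (M - 2)" using M4 mult_mono[of 4 M 2 "M-2"] by simp
    also have "\<dots> = \<mu>^2 + \<nu>^2" using eq by (simp add: M_def power2_eq_square algebra_simps)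
    finally have "rate^2 * 8 \<le> rate^2 * (\<mu>^2 + \<nu>^2)" by (intro mult_left_mono) auto
    also have "\<dots> = (rate*\<mu>)^2 + (rate*\<nu>)^2" by (simp add: algebra_simps power_mult_distrib)
    finally have "rate^2 * 8 \<le> (rate*\<mu>)^2 + (rate*\<nu>)^2" .
    moreover have "1 + r * 8 / 24 \<le> (1 + m/24) * (1 + n/24)"
      if "r * 8 \<le> m + n" "0 \<le> m" "0 \<le> n" for r m n :: real
      using that(1) mult_nonneg_nonneg[OF that(2,3)] by (simp add: algebra_simps)
    ultimately show "1 + rate^2 * 8 / 24 \<le> (1 + (rate*\<mu>)^2/24) * (1 + (rate*\<nu>)^2/24)"
      by simp
  qed (use M4 in auto)
  also have "\<dots> = (rate*\<mu> * exp (-(rate*\<mu>)/2) * (1 + (rate*\<mu>)^2/24))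
      * (rate*\<nu> * exp (-(rate*\<nu>)/2) * (1 + (rate*\<nu>)^2/24))"
  proof -
    have "exp (-(rate * M / 2)) = exp (-(rate*\<mu>)/2) * exp (-(rate*\<nu>)/2)"
      by (simp add: M_def field_simps flip: exp_add)
    moreover have "M = \<mu> * \<nu>" using eq M_def by simp
    ultimately show ?thesis by (simp add: power2_eq_square)
  qed
  also have "\<dots> \<le> (1 - exp (-(rate * \<mu>))) * (1 - exp (-(rate * \<nu>)))"
    using \<mu> \<nu> rate_pos
    by (intro mult_mono one_minus_exp_lower) auto
  finally show ?thesis .
qed

section \<open>Entropy and binomial coefficients\<close>

text \<open>The quadratic on the left vanishes at 1, and its coefficients make it touch
  \<open>- ln l\<close> at 1/2. The derivative of the difference has the roots 1/2 and
  \<open>1/k\<close>, so on the unit interval the minimum is taken at 1/2 or at 1, and both values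
  are 0.\<close>

lemma neg_ln_lower:
  fixes l :: real
  assumes "0 < l" "l \<le> 1"
  shows "(1 - l) * (2 - 4 * (1 - ln 2) * l) \<le> - ln l"
proof -
  define k :: real where "k = 4 * (1 - ln 2)"
  define W where "W = (\<lambda>l. - ln l - (1 - l) * (2 - k * l))"
  define W' where "W' = (\<lambda>l. - ((1 - 2*l) * (1 - k*l)) / l)"
  have k: "0 < k" "k \<le> 2" using ln_2_less_1 ln_le_minus_one[of "1/2"] unfolding k_def by (auto simp: ln_div)
  have D: "(W has_real_derivative W' y) (at y)" if "0 < y" for y
    unfolding W_def W'_def using that
    by (auto intro!: derivative_eq_intros simp: field_simps)
  have Whalf: "W (1/2) = 0" by (simp add: W_def k_def ln_div field_simps)
  have W1: "W 1 = 0" by (simp add: W_def)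
  have "0 \<le> W l"
  proof -
    consider "l \<le> 1/2" | "1/2 \<le> l" "l \<le> 1/k" | "1/k \<le> l" by linarith
    then show ?thesis
    proof cases
      case 1
      have "W (1/2) \<le> W l"
      proof (rule DERIV_nonpos_imp_nonincreasing[OF 1])
        fix x assume x: "l \<le> x" "x \<le> 1/2"
        then have "0 < x" using assms by simp
        moreover have "k * x \<le> 1" using mult_mono[of k 2 x "1/2"] x k \<open>0 < x\<close> by simp
        ultimately have "W' x \<le> 0" using x unfolding W'_def by (simp add: divide_nonpos_pos)
        then show "\<exists>y. (W has_real_derivative y) (at x) \<and> y \<le> 0" using D[OF \<open>0 < x\<close>] by blast
      qed
      then show ?thesis using Whalf by simp
    next
      case 2
      have "W (1/2) \<le> W l"
      proof (rule DERIV_nonneg_imp_nondecreasing[OF 2(1)])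
        fix x assume x: "1/2 \<le> x" "x \<le> l"
        then have "0 < x" by simp
        moreover have "x \<le> 1/k" using x 2 by simp
        then have "k * x \<le> 1" using k by (simp add: field_simps)
        ultimately have "0 \<le> W' x" using x unfolding W'_def
          by (intro divide_nonneg_pos) (auto simp: mult_nonpos_nonneg)
        then show "\<exists>y. (W has_real_derivative y) (at x) \<and> 0 \<le> y" using D[OF \<open>0 < x\<close>] by blast
      qed
      then show ?thesis using Whalf by simp
    next
      case 3
      have "W 1 \<le> W l"
      proof (rule DERIV_nonpos_imp_nonincreasing[OF assms(2)])
        fix x assume x: "l \<le> x" "x \<le> 1"
        then have "0 < x" using assms by simp
        moreover have "1/k \<le> x" using x 3 by simp
        then have "1 \<le> k * x" using k by (simp add: field_simps)
        moreover have "1 \<le> 2 * x" using \<open>1 \<le> k * x\<close> k \<open>0 < x\<close> mult_right_mono[of k 2 x] by linarith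
        ultimately have "W' x \<le> 0" unfolding W'_def
          by (intro divide_nonpos_pos) (auto simp: mult_nonpos_nonpos)
        then show "\<exists>y. (W has_real_derivative y) (at x) \<and> y \<le> 0" using D[OF \<open>0 < x\<close>] by blast
      qed
      then show ?thesis using W1 by simp
    qed
  qed
  then show ?thesis by (simp add: W_def k_def)
qed

lemma binomial_weight_le_1:
  fixes p q :: real
  assumes "0 \<le> p" "0 \<le> q" "p + q = 1" "n = k + l"
  shows "real (n choose k) * p ^ k * q ^ l \<le> 1"
proof -
  have "real (n choose k) * p ^ k * q ^ (n - k) \<le> (\<Sum>i\<le>n. real (n choose i) * p ^ i * q ^ (n - i))"
    by (rule member_le_sum) (use assms in auto)
  also have "\<dots> = (p + q) ^ n" by (simp add: binomial_ring)
  finally show ?thesis using assms by simp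
qed

lemma Suc_times_choose_Suc: "Suc k * (n choose Suc k) = (n - k) * (n choose k)"
  using binomial_absorb_comp[of n k] binomial_absorption[of k n] by simp

text \<open>The left side expands into \<open>x + y + 1\<close> terms, and the one with index
  \<open>x\<close> is the largest: the terms increase up to there and decrease afterwards.\<close>

lemma binomial_mode_lower:
  fixes x y :: nat
  assumes "0 < x" "0 < y"
  shows "real (x + y) ^ (x + y)
    \<le> real (x + y + 1) * (real ((x + y) choose x) * real x ^ x * real y ^ y)"
proof -
  define T where "T = (\<lambda>i. real ((x + y) choose i) * real x ^ i * real y ^ (x + y - i))"
  have T0: "0 \<le> T i" for i by (simp add: T_def)
  have rec: "T (Suc i) * (real (Suc i) * real y) = T i * (real (x + y - i) * real x)"
    if "i < x + y" for i
  proof -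
    have "real (Suc i * ((x + y) choose Suc i)) = real ((x + y - i) * ((x + y) choose i))"
      by (simp only: Suc_times_choose_Suc)
    moreover have "real y ^ (x + y - i) = real y * real y ^ (x + y - Suc i)"
      using that by (simp flip: power_Suc add: Suc_diff_Suc)
    moreover have "real x ^ Suc i = real x * real x ^ i" by simp
    moreover have "C' * X' * Y' * (s * v) = C * X * Y * (m * u)"
      if "s * C' = m * C" "Y = v * Y'" "X' = u * X" for C C' X X' Y Y' s m u v :: real
    proof -
      have "C' * X' * Y' * (s * v) = (s * C') * X' * (v * Y')" by (simp only: mult_ac)
      then show ?thesis unfolding that by (simp only: mult_ac)
    qed
    ultimately show ?thesis unfolding T_def of_nat_mult by blast
  qed
  have up: "T i \<le> T (Suc i)" if "i < x" for i
  proof -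
    have "Suc i * y \<le> (x + y - i) * x"
      using that mult_le_mono[of "Suc i" x y "x+y-i"] by (simp add: mult.commute)
    then have "real (Suc i) * real y \<le> real (x + y - i) * real x"
      by (metis of_nat_le_iff of_nat_mult)
    then have "T i * (real (Suc i) * real y) \<le> T i * (real (x + y - i) * real x)"
      using T0 by (rule mult_left_mono)
    also have "\<dots> = T (Suc i) * (real (Suc i) * real y)" using rec[of i] that by simp
    finally show ?thesis using assms by simp
  qed
  have down: "T (Suc i) \<le> T i" if "x \<le> i" "i < x + y" for i
  proof -
    have "(x + y - i) * x \<le> Suc i * y"
      using that mult_le_mono[of "x+y-i" y x "Suc i"] by (simp add: mult.commute)
    then have "real (x + y - i) * real x \<le> real (Suc i) * real y"
      by (metis of_nat_le_iff of_nat_mult)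
    then have "T i * (real (x + y - i) * real x) \<le> T i * (real (Suc i) * real y)"
      using T0 by (rule mult_left_mono)
    then have "T (Suc i) * (real (Suc i) * real y) \<le> T i * (real (Suc i) * real y)"
      using rec[of i] that by simp
    then show ?thesis using assms by simp
  qed
  have max: "T i \<le> T x" if "i \<le> x + y" for i
  proof (cases "i \<le> x")
    case True
    then show ?thesis
      by (induction rule: inc_induct) (use up order_trans in blast)+
  next
    case False
    then have "x \<le> i" by simp
    then show ?thesis using that
    proof (induction rule: dec_induct)
      case (step k)
      then show ?case using down[of k] by simp
    qed simp
  qed
  have "real (x + y) ^ (x + y) = (\<Sum>i\<le>x + y. T i)"
    unfolding T_def by (simp add: binomial_ring)
  also have "\<dots> \<le> (\<Sum>i\<le>x + y. T x)" by (rule sum_mono) (use max in auto)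
  also have "\<dots> = real (x + y + 1) * T x" by simp
  finally show ?thesis by (simp add: T_def)
qed

text \<open>Add \<open>neg_ln_lower\<close> at \<open>l\<close> and at \<open>1 - l\<close>,
  weighted by \<open>l\<close> and \<open>1 - l\<close>: the parts \<open>k * l\<close> and
  \<open>k * (1 - l)\<close> add up to a constant, and \<open>4 * ln 2 * l * (1 - l)\<close>
  remains. In bits this is the bound 4 p (1 - p) on the binary entropy, sharp at p = 1/2.\<close>

lemma entropy_lower:
  fixes x y :: nat
  assumes xy: "0 < x" "0 < y"
  defines "z \<equiv> x + y"
  shows "16 ^ (x * y) \<le> (real z ^ z / (real x ^ x * real y ^ y)) ^ z"
proof -
  define k :: real where "k = 4 * (1 - ln 2)"
  define l where "l = real x / real z"
  have z0: "z \<noteq> 0" using assms by simp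
  then have z: "0 < real z" by simp
  have l: "0 < l" "l < 1" "1 - l = real y / real z"
    using assms z by (auto simp: l_def field_simps)
  have "l * ((1 - l) * (2 - k * l)) \<le> l * - ln l"
    using neg_ln_lower[of l] l k_def by (intro mult_left_mono) auto
  moreover have "(1 - l) * ((1 - (1 - l)) * (2 - k * (1 - l))) \<le> (1 - l) * - ln (1 - l)"
    using neg_ln_lower[of "1 - l"] l k_def by (intro mult_left_mono) auto
  moreover have "l * ((1 - l) * (2 - k * l)) + (1 - l) * ((1 - (1 - l)) * (2 - k * (1 - l)))
      = 4 * ln 2 * (l * (1 - l))"
    by (simp add: k_def algebra_simps)
  ultimately have "4 * ln 2 * (l * (1 - l)) \<le> - (l * ln l) - (1 - l) * ln (1 - l)"
    by linarith
  then have "4 * ln 2 * (l * (1 - l)) * (real z * real z)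
      \<le> (- (l * ln l) - (1 - l) * ln (1 - l)) * (real z * real z)"
    by (intro mult_right_mono) auto
  also have "\<dots> = real z * (- ((l * z) * ln l) - ((1 - l) * z) * ln (1 - l))"
    by (simp add: algebra_simps)
  also have "\<dots> = real z * (real z * ln z - real x * ln x - real y * ln y)"
  proof -
    have "l * z = x" "(1 - l) * z = y" using z l by (auto simp: l_def)
    moreover have "ln l = ln x - ln z" using assms z unfolding l_def by (simp add: ln_div)
    moreover have "ln (1 - l) = ln y - ln z" using assms z unfolding l(3) by (simp add: ln_div)
    ultimately have "(l * z) * ln l + ((1 - l) * z) * ln (1 - l)
        = x * (ln x - ln z) + y * (ln y - ln z)"
      by presburger
    moreover have "x * (ln x - ln z) + y * (ln y - ln z) = x * ln x + y * ln y - z * ln z"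
      by (simp add: z_def algebra_simps)
    ultimately have "- ((l * z) * ln l) - ((1 - l) * z) * ln (1 - l)
        = real z * ln z - real x * ln x - real y * ln y"
      by linarith
    then show ?thesis by (rule arg_cong)
  qed
  finally have "4 * ln 2 * (l * (1 - l)) * (real z * real z)
      \<le> real z * (real z * ln z - real x * ln x - real y * ln y)" .
  moreover have "4 * ln 2 * (l * (1 - l)) * (real z * real z) = real (x * y) * ln 16"
  proof -
    have "(16::real) = 2 ^ 4" by simp
    then have "ln (16::real) = 4 * ln 2" by (metis ln_realpow of_nat_numeral zero_less_numeral)
    then show ?thesis using z unfolding l(3) by (simp add: l_def)
  qed
  moreover have "ln ((real z ^ z / (real x ^ x * real y ^ y)) ^ z)
      = real z * (real z * ln z - real x * ln x - real y * ln y)"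
    using xy z0 z by (simp add: ln_realpow ln_div ln_mult)
  ultimately have "ln (16 ^ (x * y)) \<le> ln ((real z ^ z / (real x ^ x * real y ^ y)) ^ z)"
    using z0 by (simp add: ln_realpow)
  then show ?thesis using assms z by (subst (asm) ln_le_cancel_iff) auto
qed

section \<open>Balancing the two degrees\<close>

text \<open>Each numerator is at most the inverse of its weight in a binomial distribution, with
  success probability \<open>1 - P\<close> or \<open>1 - Q\<close>. The powers \<open>y\<close> and
  \<open>x\<close> give \<open>1 - P\<close> and \<open>1 - Q\<close> the same exponent
  \<open>x * y\<close>. Then \<open>exp_rate_product\<close> loses at most
  \<open>16 ^ (x * y)\<close>, which the denominators \<open>z choose x\<close> win back by
  \<open>entropy_lower\<close>; the factor \<open>z + 1\<close> is the error of estimating them by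
  their entropy.\<close>

lemma degree_product_bound:
  fixes a b x y :: nat
  assumes xy: "0 < x" "0 < y"
  defines "z \<equiv> x + y" and "B \<equiv> a + b + x + y"
  defines "f \<equiv> real ((b + z) choose x) / real (z choose x)"
    and "g \<equiv> real ((a + z) choose y) / real (z choose x)"
  shows "f ^ y * g ^ x \<le> (real (z + 1) * exp (rate * B)) ^ z"
proof -
  define E where "E = real z ^ z / (real x ^ x * real y ^ y)"
  \<comment> \<open>\<open>P\<close> and \<open>Q\<close> satisfy \<open>P ^ y = Q ^ x = exp (- rate * z)\<close>, so that the exponents \<open>b + y\<close> and
    \<open>a + x\<close> in the bounds on \<open>f ^ y\<close> and \<open>g ^ x\<close> add up to \<open>B\<close>.\<close>
  define P where "P = exp (-(rate * (real z / y)))"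
  define Q where "Q = exp (-(rate * (real z / x)))"
  have z: "0 < z" using xy z_def by simp
  have E: "0 < E" using xy z by (simp add: E_def)
  have P: "0 < P" "P < 1" using xy z rate_pos by (auto simp: P_def)
  have Q: "0 < Q" "Q < 1" using xy z rate_pos by (auto simp: Q_def)
  have PY: "P ^ y = exp (-(rate * z))" using xy by (simp add: P_def flip: exp_of_nat_mult)
  have QX: "Q ^ x = exp (-(rate * z))" using xy by (simp add: Q_def flip: exp_of_nat_mult)
  have E_pow: "1 / (R * exp (-(rate * z)) ^ m) = 1 / R * exp (rate * z * m)" for R m
    by (simp add: exp_minus power_inverse field_simps flip: exp_of_nat_mult)
  have pq: "1/16 \<le> (1 - P) * (1 - Q)"
  proof -
    have eq: "real z / x * (real z / y) = real z / x + real z / y"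
      using xy by (simp add: z_def field_simps)
    have gt: "1 < real z / x" "1 < real z / y" using xy by (auto simp: z_def field_simps)
    show ?thesis
    proof (cases "real z / x \<le> real z / y")
      case True
      from exp_rate_product[OF this gt(1) eq] show ?thesis
        unfolding P_def Q_def by (simp add: mult.commute)
    next
      case False
      then have "real z / y \<le> real z / x" by simp
      from exp_rate_product[OF this gt(2)] eq show ?thesis
        unfolding P_def Q_def by (simp add: mult.commute add.commute)
    qed
  qed
  have Cpos: "0 < real (z choose x)" by (simp add: z_def)
  have Cinv: "1 / real (z choose x) \<le> real (z + 1) / E"
    using binomial_mode_lower[OF xy] E Cpos xy z unfolding E_def z_def[symmetric]
    by (simp add: field_simps)
  have f0: "0 \<le> f" and g0: "0 \<le> g" by (auto simp: f_def g_def)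
  have "real ((b + z) choose x) * (1 - P) ^ x * P ^ (b + y) \<le> 1"
    by (rule binomial_weight_le_1) (use P z_def in auto)
  then have "real ((b + z) choose x) \<le> 1 / ((1 - P) ^ x * P ^ (b + y))"
    using P by (simp add: field_simps)
  then have "real ((b + z) choose x) * (1 / real (z choose x))
      \<le> 1 / ((1 - P) ^ x * P ^ (b + y)) * (real (z + 1) / E)"
    using Cinv P by (intro mult_mono) auto
  then have "f ^ y \<le> (1 / ((1 - P) ^ x * P ^ (b + y)) * (real (z + 1) / E)) ^ y"
    using f0 by (intro power_mono) (auto simp: f_def)
  also have "\<dots> = (real (z + 1) / E) ^ y * (1 / ((1 - P) ^ (x * y) * (P ^ y) ^ (b + y)))"
    by (simp add: power_mult_distrib power_divide mult.commute flip: power_mult)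
  also have "\<dots> = (real (z + 1) / E) ^ y * (1 / (1 - P) ^ (x * y)) * exp (rate * z * (b + y))"
    unfolding PY E_pow by simp
  finally have F: "f ^ y
      \<le> (real (z + 1) / E) ^ y * (1 / (1 - P) ^ (x * y)) * exp (rate * z * (b + y))" .
  have "real ((a + z) choose y) * (1 - Q) ^ y * Q ^ (a + x) \<le> 1"
    by (rule binomial_weight_le_1) (use Q z_def in auto)
  then have "real ((a + z) choose y) \<le> 1 / ((1 - Q) ^ y * Q ^ (a + x))"
    using Q by (simp add: field_simps)
  then have "real ((a + z) choose y) * (1 / real (z choose x))
      \<le> 1 / ((1 - Q) ^ y * Q ^ (a + x)) * (real (z + 1) / E)"
    using Cinv Q by (intro mult_mono) auto
  then have "g ^ x \<le> (1 / ((1 - Q) ^ y * Q ^ (a + x)) * (real (z + 1) / E)) ^ x"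
    using g0 by (intro power_mono) (auto simp: g_def)
  also have "\<dots> = (real (z + 1) / E) ^ x * (1 / ((1 - Q) ^ (x * y) * (Q ^ x) ^ (a + x)))"
    by (simp add: power_mult_distrib power_divide mult.commute flip: power_mult)
  also have "\<dots> = (real (z + 1) / E) ^ x * (1 / (1 - Q) ^ (x * y)) * exp (rate * z * (a + x))"
    unfolding QX E_pow by simp
  finally have G: "g ^ x
      \<le> (real (z + 1) / E) ^ x * (1 / (1 - Q) ^ (x * y)) * exp (rate * z * (a + x))" .
  have "f ^ y * g ^ x
      \<le> ((real (z + 1) / E) ^ y * (1 / (1 - P) ^ (x * y)) * exp (rate * z * (b + y)))
        * ((real (z + 1) / E) ^ x * (1 / (1 - Q) ^ (x * y)) * exp (rate * z * (a + x)))"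
    using F G f0 g0 P E by (intro mult_mono) auto
  also have "\<dots> = (real (z + 1) / E) ^ z * (1 / ((1 - P) * (1 - Q)) ^ (x * y))
      * (exp (rate * z * (b + y)) * exp (rate * z * (a + x)))"
    by (simp add: z_def power_add power_mult_distrib)
  also have "exp (rate * z * (b + y)) * exp (rate * z * (a + x)) = exp (rate * B) ^ z"
    by (simp add: B_def field_simps flip: exp_add exp_of_nat_mult)
  also have "(real (z + 1) / E) ^ z * (1 / ((1 - P) * (1 - Q)) ^ (x * y)) * exp (rate * B) ^ z
      \<le> (real (z + 1)) ^ z * exp (rate * B) ^ z"
  proof (rule mult_right_mono)
    have "(1/16) ^ (x * y) \<le> ((1 - P) * (1 - Q)) ^ (x * y)"
      using pq by (intro power_mono) auto
    moreover have "16 ^ (x * y) \<le> E ^ z"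
      using entropy_lower[OF xy] unfolding E_def z_def by simp
    ultimately have "16 ^ (x * y) * (1/16) ^ (x * y) \<le> E ^ z * ((1 - P) * (1 - Q)) ^ (x * y)"
      using E by (intro mult_mono) auto
    then have "1 \<le> E ^ z * ((1 - P) * (1 - Q)) ^ (x * y)"
      by (simp flip: power_mult_distrib)
    then have "real (z + 1) ^ z * (1 / (E ^ z * ((1 - P) * (1 - Q)) ^ (x * y))) \<le> real (z + 1) ^ z * 1"
      by (intro mult_left_mono) auto
    then show "(real (z + 1) / E) ^ z * (1 / ((1 - P) * (1 - Q)) ^ (x * y)) \<le> real (z + 1) ^ z"
      by (simp add: power_divide)
  qed simp
  finally show ?thesis by (simp add: power_mult_distrib)
qed

text \<open>By \<open>degree_product_bound\<close> the smaller of \<open>f x\<close> and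
  \<open>g x\<close> is at most \<open>K\<close>. At the last \<open>x\<close> with
  \<open>f x \<le> g x\<close> this bounds \<open>f x\<close>, at the next index it bounds
  \<open>g\<close>, and one step back multiplies \<open>g\<close> by at most
  \<open>B + 1\<close>.\<close>

lemma balanced_split:
  fixes a b z :: nat
  defines "B \<equiv> a + b + z"
  obtains x where "x \<le> z"
    "real ((b + z) choose x) \<le> real (B + 1)^2 * exp (rate * B) * real (z choose x)"
    "real ((a + z) choose (z - x)) \<le> real (B + 1)^2 * exp (rate * B) * real (z choose x)"
proof -
  define f where "f = (\<lambda>x. real ((b + z) choose x) / real (z choose x))"
  define g where "g = (\<lambda>x. real ((a + z) choose (z - x)) / real (z choose x))"
  define K where "K = real (z + 1) * exp (rate * B)"
  define D where "D = real (B + 1)^2 * exp (rate * B)"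
  have e1: "1 \<le> exp (rate * B)" using rate_pos by simp
  have K1: "1 \<le> K" unfolding K_def using mult_mono[OF _ e1, of 1 "real (z+1)"] by simp
  have KD: "real (B + 1) * K \<le> D"
    unfolding K_def D_def by (simp add: B_def power2_eq_square algebra_simps)
  have "1 * K \<le> real (B + 1) * K" using K1 by (intro mult_right_mono) auto
  then have KD': "K \<le> D" using KD by simp
  have fg0: "0 \<le> f x" "0 \<le> g x" for x by (auto simp: f_def g_def)
  have prod: "f x ^ (z - x) * g x ^ x \<le> K ^ z" if "0 < x" "x < z" for x
    using degree_product_bound[of x "z - x" b a] that
    unfolding f_def g_def K_def B_def by (simp add: add.assoc)
  have fK: "f x \<le> K" if "x < z" "f x \<le> g x" for x
  proof (cases "x = 0")
    case True
    then show ?thesis using K1 by (simp add: f_def)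
  next
    case False
    have "f x ^ z = f x ^ (z - x) * f x ^ x" using that by (simp flip: power_add)
    also have "\<dots> \<le> f x ^ (z - x) * g x ^ x"
      using that fg0 by (intro mult_left_mono power_mono) auto
    also have "\<dots> \<le> K ^ z" using prod False that by simp
    finally show ?thesis using power_mono_iff[of "f x" K z] fg0[of x] K1 that by simp
  qed
  have gK: "g x \<le> K" if "0 < x" "x \<le> z" "g x \<le> f x" for x
  proof (cases "x = z")
    case True
    then show ?thesis using K1 by (simp add: g_def)
  next
    case False
    have "g x ^ z = g x ^ (z - x) * g x ^ x" using that by (simp flip: power_add)
    also have "\<dots> \<le> f x ^ (z - x) * g x ^ x"
      using that fg0 by (intro mult_right_mono power_mono) auto
    also have "\<dots> \<le> K ^ z" using prod False that by simp
    finally show ?thesis using power_mono_iff[of "g x" K z] fg0[of x] K1 that by simp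
  qed
  have "\<exists>x\<le>z. f x \<le> D \<and> g x \<le> D"
  proof (cases "f z \<le> g z")
    case True
    moreover have "g z \<le> 1" by (simp add: g_def)
    ultimately show ?thesis using K1 KD' by (intro exI[of _ z]) auto
  next
    case False
    \<comment> \<open>The maximum exists because \<open>f 0 = 1 \<le> g 0\<close>; in this case it
      is not \<open>z\<close>, so it has a successor in the range.\<close>
    define x where "x = (GREATEST x. x \<le> z \<and> f x \<le> g x)"
    have ex: "0 \<le> z \<and> f 0 \<le> g 0"
    proof -
      have "1 \<le> (a + z) choose z" by (simp add: Suc_le_eq)
      then have "1 \<le> real ((a + z) choose z)" by linarith
      then show ?thesis by (simp add: f_def g_def)
    qed
    have x: "x \<le> z \<and> f x \<le> g x"
      unfolding x_def by (rule GreatestI_nat[of _ 0 z]) (use ex in auto)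
    then have xz: "x < z" using False by (metis le_neq_implies_less)
    have "\<not> (Suc x \<le> z \<and> f (Suc x) \<le> g (Suc x))"
      using Greatest_le_nat[of "\<lambda>x. x \<le> z \<and> f x \<le> g x" "Suc x" z] unfolding x_def by auto
    then have "g (Suc x) \<le> f (Suc x)" using xz by auto
    then have g1: "g (Suc x) \<le> K" using gK xz by simp
    \<comment> \<open>By the ratios of adjacent binomials, \<open>g x / g (Suc x)\<close> equals
      \<open>(a + x + 1) / (x + 1)\<close>.\<close>
    have "g x \<le> real (B + 1) * g (Suc x)"
    proof -
      define y where "y = z - Suc x"
      have zx: "z = x + Suc y" using xz y_def by simp
      have A: "real (Suc y) * real ((a + z) choose (Suc y)) = real (a + Suc x) * real ((a + z) choose y)"
        using Suc_times_choose_Suc[of y "a + z"] zx unfolding of_nat_mult[symmetric] by simp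
      have Z: "real (Suc x) * real (z choose Suc x) = real (Suc y) * real (z choose x)"
        using Suc_times_choose_Suc[of x z] zx unfolding of_nat_mult[symmetric] by simp
      have "real (a + Suc x) * 1 \<le> real (B + 1) * real (Suc x)"
        using zx unfolding B_def by (intro mult_mono) auto
      then have "real (a + Suc x) * real ((a + z) choose y) \<le> real (B + 1) * real (Suc x) * real ((a + z) choose y)"
        by (intro mult_right_mono) auto
      then have le: "real (Suc y) * real ((a + z) choose (Suc y)) \<le> real (B + 1) * real (Suc x) * real ((a + z) choose y)"
        using A by simp
      have "g x = (real (Suc y) * real ((a + z) choose (Suc y))) / (real (Suc y) * real (z choose x))"
        using zx by (simp add: g_def)
      also have "\<dots> \<le> (real (B + 1) * real (Suc x) * real ((a + z) choose y)) / (real (Suc y) * real (z choose x))"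
        using le by (rule divide_right_mono) simp
      also have "\<dots> = (real (Suc x) * (real (B + 1) * real ((a + z) choose y))) / (real (Suc x) * real (z choose Suc x))"
        unfolding Z by (simp only: mult_ac)
      also have "\<dots> = (real (B + 1) * real ((a + z) choose y)) / real (z choose Suc x)"
        by (rule mult_divide_mult_cancel_left) simp
      also have "\<dots> = real (B + 1) * g (Suc x)"
        by (simp add: g_def y_def)
      finally show ?thesis .
    qed
    also have "\<dots> \<le> real (B + 1) * K" using g1 by (intro mult_left_mono) auto
    also have "\<dots> \<le> D" by (rule KD)
    finally have "g x \<le> D" .
    moreover have "f x \<le> D" using fK[of x] x xz KD' by simp
    ultimately show ?thesis using x by blast
  qed
  then obtain x where x: "x \<le> z" "f x \<le> D" "g x \<le> D" by blast
  have "0 < real (z choose x)" using x by simp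
  then have "real ((b + z) choose x) \<le> D * real (z choose x)"
    "real ((a + z) choose (z - x)) \<le> D * real (z choose x)"
    using x(2,3) unfolding f_def g_def by (simp_all only: pos_divide_le_eq)
  then show ?thesis using that[of x] x(1) unfolding D_def by blast
qed

section \<open>Separating families\<close>

lemma exists_le_average:
  fixes f :: "'a \<Rightarrow> real"
  assumes "finite A" "A \<noteq> {}" "(\<Sum>x\<in>A. f x) \<le> real (card A) * c"
  obtains x where "x \<in> A" "f x \<le> c"
proof -
  have "\<exists>x\<in>A. f x \<le> c"
  proof (rule ccontr)
    assume "\<not> ?thesis"
    then have "(\<Sum>x\<in>A. c) < (\<Sum>x\<in>A. f x)"
      using assms by (intro sum_strict_mono) auto
    then show False using assms(3) by simp
  qed
  then show ?thesis using that by blast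
qed

text \<open>
  The method of conditional expectations, with the number of sets not yet hit and the exponential
  moments of the loads as potential.
\<close>

lemma potential_sampling:
  fixes H P :: "'a set set" and \<alpha> \<beta> :: real
  assumes \<Omega>: "finite \<Omega>" "\<Omega> \<noteq> {}"
    and H: "finite H" "\<And>h. h \<in> H \<Longrightarrow> h \<subseteq> \<Omega> \<and> G \<le> card h"
    and P: "finite P" "\<And>p. p \<in> P \<Longrightarrow> p \<subseteq> \<Omega> \<and> real (card p) \<le> q"
    and "0 \<le> \<alpha>" "0 \<le> \<beta>" "G \<le> card \<Omega>" "0 \<le> q"
  shows "\<exists>xs. length xs = m \<and> set xs \<subseteq> \<Omega> \<and>
     \<alpha> * real (card {h \<in> H. set xs \<inter> h = {}}) + \<beta> * (\<Sum>p\<in>P. 2 ^ length (filter (\<lambda>x. x \<in> p) xs))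
     \<le> \<alpha> * real (card H) * (1 - real G / card \<Omega>) ^ m + \<beta> * real (card P) * (1 + q / card \<Omega>) ^ m"
  using \<open>0 \<le> \<alpha>\<close> \<open>0 \<le> \<beta>\<close>
proof (induction m arbitrary: \<alpha> \<beta>)
  case 0
  then show ?case by simp
next
  case (Suc m)
  define N where "N = real (card \<Omega>)"
  have N: "0 < N" using \<Omega> by (simp add: N_def card_gt_0_iff)
  have shrink: "0 \<le> 1 - real G / N" using \<open>G \<le> card \<Omega>\<close> N by (simp add: N_def)
  have grow: "0 \<le> 1 + q / N" using \<open>0 \<le> q\<close> N by simp
  \<comment> \<open>The weights handed to the induction hypothesis already contain the average
    change caused by one further sample, which is then put in front of \<open>xs\<close>.\<close>
  obtain xs where xs: "length xs = m" "set xs \<subseteq> \<Omega>" and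
    le: "(\<alpha> * (1 - real G / N)) * real (card {h \<in> H. set xs \<inter> h = {}})
       + (\<beta> * (1 + q / N)) * (\<Sum>p\<in>P. 2 ^ length (filter (\<lambda>x. x \<in> p) xs))
     \<le> (\<alpha> * (1 - real G / N)) * real (card H) * (1 - real G / N) ^ m
       + (\<beta> * (1 + q / N)) * real (card P) * (1 + q / N) ^ m"
    using Suc.IH[of "\<alpha> * (1 - real G / N)" "\<beta> * (1 + q / N)"] Suc.prems shrink grow
    unfolding N_def by auto
  define U where "U = {h \<in> H. set xs \<inter> h = {}}"
  define W where "W = (\<lambda>p. 2 ^ length (filter (\<lambda>x. x \<in> p) xs) :: real)"
  have finU: "finite U" using H by (simp add: U_def)
  have unhit: "(\<Sum>y\<in>\<Omega>. real (card {h \<in> H. set (y # xs) \<inter> h = {}}))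
      \<le> N * ((1 - real G / N) * real (card U))"
  proof -
    have "(\<Sum>y\<in>\<Omega>. real (card {h \<in> H. set (y # xs) \<inter> h = {}}))
        = (\<Sum>y\<in>\<Omega>. \<Sum>h\<in>U. of_bool (y \<notin> h))"
    proof (rule sum.cong)
      fix y
      have "{h \<in> H. set (y # xs) \<inter> h = {}} = {h \<in> U. y \<notin> h}" by (auto simp: U_def)
      then show "real (card {h \<in> H. set (y # xs) \<inter> h = {}}) = (\<Sum>h\<in>U. of_bool (y \<notin> h))"
        using finU by (simp add: sum.If_cases of_bool_def Int_def)
    qed simp
    also have "\<dots> = (\<Sum>h\<in>U. \<Sum>y\<in>\<Omega>. of_bool (y \<notin> h))" by (rule sum.swap)
    also have "\<dots> \<le> (\<Sum>h\<in>U. N - real G)"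
    proof (rule sum_mono)
      fix h assume "h \<in> U"
      then have h: "h \<subseteq> \<Omega>" "G \<le> card h" using H by (auto simp: U_def)
      have "(\<Sum>y\<in>\<Omega>. of_bool (y \<notin> h)) = real (card (\<Omega> - h))"
        using \<Omega> by (simp add: sum.If_cases of_bool_def Int_def set_diff_eq)
      also have "\<dots> = N - real (card h)"
        using \<Omega> h by (simp add: card_Diff_subset finite_subset card_mono of_nat_diff N_def)
      finally show "(\<Sum>y\<in>\<Omega>. of_bool (y \<notin> h)) \<le> N - real G" using h by simp
    qed
    also have "\<dots> = N * ((1 - real G / N) * real (card U))" using N by (simp add: field_simps)
    finally show ?thesis .
  qed
  have load: "(\<Sum>y\<in>\<Omega>. \<Sum>p\<in>P. 2 ^ length (filter (\<lambda>x. x \<in> p) (y # xs)))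
      \<le> N * ((1 + q / N) * (\<Sum>p\<in>P. W p))"
  proof -
    have "(\<Sum>y\<in>\<Omega>. \<Sum>p\<in>P. 2 ^ length (filter (\<lambda>x. x \<in> p) (y # xs)))
        = (\<Sum>y\<in>\<Omega>. \<Sum>p\<in>P. W p * (1 + of_bool (y \<in> p)))"
      by (intro sum.cong) (auto simp: W_def)
    also have "\<dots> = (\<Sum>p\<in>P. \<Sum>y\<in>\<Omega>. W p * (1 + of_bool (y \<in> p)))" by (rule sum.swap)
    also have "\<dots> \<le> (\<Sum>p\<in>P. W p * (N + q))"
    proof (rule sum_mono)
      fix p assume "p \<in> P"
      then have p: "p \<subseteq> \<Omega>" "card p \<le> q" using P by auto
      have "(\<Sum>y\<in>\<Omega>. of_bool (y \<in> p)) = real (card p)"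
        using \<Omega> p by (simp add: sum.If_cases of_bool_def Int_absorb1)
      then have "(\<Sum>y\<in>\<Omega>. W p * (1 + of_bool (y \<in> p))) = W p * (N + real (card p))"
        by (simp add: sum_distrib_left[symmetric] sum.distrib N_def)
      also have "\<dots> \<le> W p * (N + q)" using p by (intro mult_left_mono) (auto simp: W_def)
      finally show "(\<Sum>y\<in>\<Omega>. W p * (1 + of_bool (y \<in> p))) \<le> W p * (N + q)" .
    qed
    also have "\<dots> = N * ((1 + q / N) * (\<Sum>p\<in>P. W p))"
      using N unfolding sum_distrib_right[symmetric] by (simp add: field_simps)
    finally show ?thesis .
  qed
  define c where "c = \<alpha> * ((1 - real G / N) * real (card U)) + \<beta> * ((1 + q / N) * (\<Sum>p\<in>P. W p))"
  have "(\<Sum>y\<in>\<Omega>. \<alpha> * real (card {h \<in> H. set (y # xs) \<inter> h = {}})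
      + \<beta> * (\<Sum>p\<in>P. 2 ^ length (filter (\<lambda>x. x \<in> p) (y # xs))))
    = \<alpha> * (\<Sum>y\<in>\<Omega>. real (card {h \<in> H. set (y # xs) \<inter> h = {}}))
      + \<beta> * (\<Sum>y\<in>\<Omega>. \<Sum>p\<in>P. 2 ^ length (filter (\<lambda>x. x \<in> p) (y # xs)))"
    by (simp only: sum.distrib sum_distrib_left)
  also have "\<dots> \<le> \<alpha> * (N * ((1 - real G / N) * real (card U))) + \<beta> * (N * ((1 + q / N) * (\<Sum>p\<in>P. W p)))"
    using unhit load Suc.prems by (intro add_mono mult_left_mono) auto
  also have "\<dots> = real (card \<Omega>) * c" unfolding c_def N_def by (simp only: distrib_left mult_ac)
  finally obtain y where y: "y \<in> \<Omega>" and ley: "\<alpha> * real (card {h \<in> H. set (y # xs) \<inter> h = {}})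
      + \<beta> * (\<Sum>p\<in>P. 2 ^ length (filter (\<lambda>x. x \<in> p) (y # xs))) \<le> c"
    using exists_le_average[OF \<Omega>] by blast
  have "c \<le> \<alpha> * real (card H) * (1 - real G / N) ^ Suc m + \<beta> * real (card P) * (1 + q / N) ^ Suc m"
    using le unfolding c_def U_def W_def by (simp only: power_Suc mult_ac)
  then show ?case
    using y ley xs unfolding N_def by (intro exI[of _ "y # xs"]) auto
qed

text \<open>With about \<open>N * L / G\<close> samples a single \<open>h\<close> stays unhit with
  probability at most \<open>exp (- L) = 1 / (4 * M)\<close>, so the expected number of unhit sets
  is at most 1/4. The weight \<beta> is such that the exponential moments add at most another 1/4. A
  total of 1/2 excludes any unhit set and bounds every load by a logarithm of
  \<open>1 / \<beta>\<close>.\<close>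

lemma sampling:
  fixes H P :: "'a set set" and M D :: real
  assumes \<Omega>: "finite \<Omega>"
    and H: "finite H" "\<And>h. h \<in> H \<Longrightarrow> h \<subseteq> \<Omega> \<and> card h = G"
    and P: "finite P" "\<And>p. p \<in> P \<Longrightarrow> p \<subseteq> \<Omega> \<and> real (card p) \<le> D * G"
    and M: "1 \<le> M" "real (card H) \<le> M" "real (card P) \<le> M"
    and D: "1 \<le> D" and G: "0 < G" "G \<le> card \<Omega>"
  obtains xs where "set xs \<subseteq> \<Omega>" "\<And>h. h \<in> H \<Longrightarrow> set xs \<inter> h \<noteq> {}"
    "\<And>p. p \<in> P \<Longrightarrow> real (length (filter (\<lambda>x. x \<in> p) xs)) \<le> 4 * D * (ln (4 * M) + 1)"
proof -
  define N where "N = real (card \<Omega>)"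
  define L where "L = ln (4 * M)"
  define m where "m = nat \<lceil>N * L / G\<rceil>"
  \<comment> \<open>The cap at \<open>N\<close> gives \<open>q / N \<le> 1\<close>, which pays for
    the extra sample from rounding \<open>m\<close> up.\<close>
  define q where "q = min (D * G) N"
  define \<beta> where "\<beta> = 1 / (4 * M * exp (D * (L + 1)))"
  have \<Omega>0: "\<Omega> \<noteq> {}" using G by auto
  have N: "0 < N" "real G \<le> N" using G by (auto simp: N_def)
  have L: "0 \<le> L" using M by (simp add: L_def)
  have expL: "exp (- L) = 1 / (4 * M)" using M by (simp add: L_def exp_minus inverse_eq_divide)
  have m: "N * L / G \<le> m" "m \<le> N * L / G + 1"
    using N L G unfolding m_def by (auto intro: real_nat_ceiling_ge of_nat_ceiling)
  have q: "0 \<le> q" "q \<le> D * G" "q \<le> N" using D N by (auto simp: q_def)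
  have P': "p \<subseteq> \<Omega> \<and> real (card p) \<le> q" if "p \<in> P" for p
    using P(2)[OF that] card_mono[OF \<Omega>, of p] by (simp add: q_def N_def)
  have \<beta>: "0 < \<beta>" using M by (simp add: \<beta>_def)
  obtain xs where xs: "set xs \<subseteq> \<Omega>" and le:
    "1 * real (card {h \<in> H. set xs \<inter> h = {}}) + \<beta> * (\<Sum>p\<in>P. 2 ^ length (filter (\<lambda>x. x \<in> p) xs))
     \<le> 1 * real (card H) * (1 - real G / N) ^ m + \<beta> * real (card P) * (1 + q / N) ^ m"
    using potential_sampling[OF \<Omega> \<Omega>0 H(1) _ P(1) P', of G 1 \<beta> m] H(2) \<beta> G q
    unfolding N_def by auto
  have "(1 - real G / N) ^ m \<le> exp (- (real G / N)) ^ m"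
    using N exp_ge_add_one_self[of "- (real G / N)"] by (intro power_mono) auto
  also have "\<dots> = exp (- (real G / N * m))" by (simp flip: exp_of_nat_mult add: mult.commute)
  also have "\<dots> \<le> exp (- L)"
    using m(1) N G by (simp add: field_simps)
  finally have 1: "(1 - real G / N) ^ m \<le> 1 / (4 * M)" using expL by simp
  have "(1 + q / N) ^ m \<le> exp (q / N) ^ m"
    using N q exp_ge_add_one_self[of "q / N"] by (intro power_mono) auto
  also have "\<dots> = exp (q / N * m)" by (simp flip: exp_of_nat_mult add: mult.commute)
  also have "q / N * m \<le> D * (L + 1)"
  proof -
    have "q / N * m \<le> q / N * (N * L / G + 1)" using m(2) q N by (intro mult_left_mono) auto
    also have "\<dots> = q / G * L + q / N" using N by (simp add: field_simps)
    also have "\<dots> \<le> D * L + 1"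
      using q N L G by (intro add_mono mult_right_mono) (auto simp: field_simps)
    also have "\<dots> \<le> D * (L + 1)" using D by (simp add: algebra_simps)
    finally show ?thesis .
  qed
  finally have 2: "(1 + q / N) ^ m \<le> exp (D * (L + 1))" by simp
  have "1 * real (card H) * (1 - real G / N) ^ m + \<beta> * real (card P) * (1 + q / N) ^ m
      \<le> M * (1 / (4 * M)) + \<beta> * M * exp (D * (L + 1))"
    using 1 2 M \<beta> N q by (intro add_mono mult_mono) auto
  also have "\<dots> = 1 / 2" using M by (simp add: \<beta>_def)
  finally have half: "real (card {h \<in> H. set xs \<inter> h = {}})
      + \<beta> * (\<Sum>p\<in>P. 2 ^ length (filter (\<lambda>x. x \<in> p) xs)) \<le> 1 / 2" using le by simp
  have nonneg: "0 \<le> \<beta> * (\<Sum>p\<in>P. 2 ^ length (filter (\<lambda>x. x \<in> p) xs))"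
    using \<beta> by (simp add: sum_nonneg)
  show ?thesis
  proof (rule that)
    show "set xs \<subseteq> \<Omega>" by (rule xs)
    have "real (card {h \<in> H. set xs \<inter> h = {}}) < 1" using half nonneg by simp
    then have "{h \<in> H. set xs \<inter> h = {}} = {}" using H(1) by simp
    then show "set xs \<inter> h \<noteq> {}" if "h \<in> H" for h using that by blast
  next
    fix p assume p: "p \<in> P"
    define t where "t = length (filter (\<lambda>x. x \<in> p) xs)"
    have "2 ^ t \<le> (\<Sum>p\<in>P. 2 ^ length (filter (\<lambda>x. x \<in> p) xs) :: real)"
      unfolding t_def using p P(1) by (intro member_le_sum) auto
    then have "\<beta> * 2 ^ t \<le> \<beta> * (\<Sum>p\<in>P. 2 ^ length (filter (\<lambda>x. x \<in> p) xs))"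
      using \<beta> by (intro mult_left_mono) auto
    also have "\<dots> \<le> 1 / 2" using half by simp
    finally have "2 ^ t \<le> 1 / (2 * \<beta>)" using \<beta> by (simp add: field_simps)
    also have "\<dots> \<le> exp L * exp (D * (L + 1))"
      using M by (simp add: \<beta>_def L_def)
    also have "\<dots> \<le> exp (D * (L + 1)) * exp (D * (L + 1))"
    proof (intro mult_right_mono)
      have "1 * (L + 1) \<le> D * (L + 1)" using D L by (intro mult_right_mono) auto
      then show "exp L \<le> exp (D * (L + 1))" by simp
    qed simp
    also have "\<dots> = exp (2 * D * (L + 1))" by (simp flip: exp_add)
    finally have "ln (2 ^ t) \<le> ln (exp (2 * D * (L + 1)))" by (subst ln_le_cancel_iff) auto
    then have "real t * ln 2 \<le> 2 * D * (L + 1)" by (simp add: ln_realpow)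
    moreover have "real t * (1/2) \<le> real t * ln 2"
      using ln_le_minus_one[of "1/2"] by (intro mult_left_mono) (auto simp: ln_div)
    ultimately show "real (length (filter (\<lambda>x. x \<in> p) xs)) \<le> 4 * D * (ln (4 * M) + 1)"
      unfolding t_def L_def by simp
  qed
qed

section \<open>Families that separate disjoint sets\<close>

lemma card_subsets_between:
  assumes "finite Y" "U \<subseteq> Y"
  shows "card {S. U \<subseteq> S \<and> S \<subseteq> Y \<and> card S = card U + x} = (card Y - card U) choose x"
proof -
  have finU: "finite U" using assms finite_subset by blast
  have "bij_betw (\<lambda>T. U \<union> T) {T. T \<subseteq> Y - U \<and> card T = x}
      {S. U \<subseteq> S \<and> S \<subseteq> Y \<and> card S = card U + x}"
  proof (rule bij_betw_byWitness[where f' = "\<lambda>S. S - U"])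
    show "(\<lambda>T. U \<union> T) ` {T. T \<subseteq> Y - U \<and> card T = x}
        \<subseteq> {S. U \<subseteq> S \<and> S \<subseteq> Y \<and> card S = card U + x}"
    proof safe
      fix T assume T: "T \<subseteq> Y - U"
      then have "finite T" using assms finite_subset by blast
      with T finU show "card (U \<union> T) = card U + card T" by (intro card_Un_disjoint) auto
    qed (use assms in auto)
    show "(\<lambda>S. S - U) ` {S. U \<subseteq> S \<and> S \<subseteq> Y \<and> card S = card U + x}
        \<subseteq> {T. T \<subseteq> Y - U \<and> card T = x}"
      using finU by (auto simp: card_Diff_subset)
  qed auto
  then have "card {S. U \<subseteq> S \<and> S \<subseteq> Y \<and> card S = card U + x} = card {T. T \<subseteq> Y - U \<and> card T = x}"
    by (simp add: bij_betw_same_card)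
  also have "\<dots> = (card Y - card U) choose x"
    using assms finU by (simp add: n_subsets card_Diff_subset)
  finally show ?thesis .
qed

text \<open>For fixed sizes every disjoint pair has the same number \<open>z choose x\<close> of
  separating sets, and \<open>balanced_split\<close> compares exactly this number with the number of
  candidates compatible with one set alone. Hence \<open>sampling\<close> applies with ratio
  \<open>D\<close>, and its logarithm is linear in \<open>B\<close>. The family is a list because
  samples may repeat.\<close>

lemma separating_family:
  fixes B a b :: nat
  assumes "a + b \<le> B"
  obtains F where
    "\<And>U V. U \<subseteq> {..<B} \<Longrightarrow> V \<subseteq> {..<B} \<Longrightarrow> card U = a \<Longrightarrow> card V = b \<Longrightarrow> U \<inter> V = {}
       \<Longrightarrow> \<exists>S\<in>set F. U \<subseteq> S \<and> S \<inter> V = {}"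
    "\<And>U. U \<subseteq> {..<B} \<Longrightarrow> card U = a
       \<Longrightarrow> real (length (filter (\<lambda>S. U \<subseteq> S) F)) \<le> 8 * real (B + 2)^3 * exp (rate * B)"
    "\<And>V. V \<subseteq> {..<B} \<Longrightarrow> card V = b
       \<Longrightarrow> real (length (filter (\<lambda>S. S \<inter> V = {}) F)) \<le> 8 * real (B + 2)^3 * exp (rate * B)"
proof -
  define z where "z = B - a - b"
  have Bz: "B = a + b + z" using assms by (simp add: z_def)
  obtain x where x: "x \<le> z"
    "real ((b + z) choose x) \<le> real (B + 1)^2 * exp (rate * B) * real (z choose x)"
    "real ((a + z) choose (z - x)) \<le> real (B + 1)^2 * exp (rate * B) * real (z choose x)"
    using balanced_split[of z b a] unfolding Bz by blast
  define D where "D = real (B + 1)^2 * exp (rate * B)"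
  \<comment> \<open>There are at most \<open>4 ^ B\<close> pairs to be separated and at most
    \<open>2 * 2 ^ B\<close> single sets whose load counts.\<close>
  define M :: real where "M = 2 * 4 ^ B"
  define \<Omega> where "\<Omega> = {S. S \<subseteq> {..<B} \<and> card S = a + x}"
  define sep where "sep = (\<lambda>(U, V). {S \<in> \<Omega>. U \<subseteq> S \<and> S \<inter> V = {}})"
  define H where "H = sep ` {(U, V). U \<subseteq> {..<B} \<and> V \<subseteq> {..<B} \<and> card U = a \<and> card V = b \<and> U \<inter> V = {}}"
  define P where "P = (\<lambda>U. sep (U, {})) ` {U. U \<subseteq> {..<B} \<and> card U = a}
      \<union> (\<lambda>V. sep ({}, V)) ` {V. V \<subseteq> {..<B} \<and> card V = b}"
  have fin\<Omega>: "finite \<Omega>" by (rule finite_subset[of _ "Pow {..<B}"]) (auto simp: \<Omega>_def)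
  have sub: "sep p \<subseteq> \<Omega>" for p by (auto simp: sep_def split: prod.split)
  have card_sep: "card (sep (U, V)) = z choose x"
    if "U \<subseteq> {..<B}" "V \<subseteq> {..<B}" "card U = a" "card V = b" "U \<inter> V = {}" for U V
  proof -
    have "sep (U, V) = {S. U \<subseteq> S \<and> S \<subseteq> {..<B} - V \<and> card S = card U + x}"
      using that by (auto simp: sep_def \<Omega>_def)
    also have "card \<dots> = (card ({..<B} - V) - card U) choose x"
      using that by (intro card_subsets_between) auto
    also have "card ({..<B} - V) - card U = z"
      using that by (simp add: card_Diff_subset finite_subset[OF _ finite_lessThan] z_def)
    finally show ?thesis .
  qed
  have card_sepU: "card (sep (U, {})) = (b + z) choose x" if "U \<subseteq> {..<B}" "card U = a" for U
  proof -
    have "sep (U, {}) = {S. U \<subseteq> S \<and> S \<subseteq> {..<B} \<and> card S = card U + x}"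
      using that by (auto simp: sep_def \<Omega>_def)
    also have "card \<dots> = (card {..<B} - card U) choose x"
      using that by (intro card_subsets_between) auto
    finally show ?thesis using that Bz by simp
  qed
  have card_sepV: "card (sep ({}, V)) = (a + z) choose (z - x)" if "V \<subseteq> {..<B}" "card V = b" for V
  proof -
    have "sep ({}, V) = {S. {} \<subseteq> S \<and> S \<subseteq> {..<B} - V \<and> card S = card ({}::nat set) + (a + x)}"
      using that by (auto simp: sep_def \<Omega>_def)
    also have "card \<dots> = (card ({..<B} - V) - card ({}::nat set)) choose (a + x)"
      by (rule card_subsets_between) auto
    also have "card ({..<B} - V) - card ({}::nat set) = a + z"
      using that by (simp add: card_Diff_subset finite_subset[OF _ finite_lessThan] Bz)
    also have "(a + z) choose (a + x) = (a + z) choose (z - x)"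
      using binomial_symmetric[of "a + x" "a + z"] x by simp
    finally show ?thesis .
  qed
  obtain F where F: "set F \<subseteq> \<Omega>" "\<And>h. h \<in> H \<Longrightarrow> set F \<inter> h \<noteq> {}"
    "\<And>p. p \<in> P \<Longrightarrow> real (length (filter (\<lambda>S. S \<in> p) F)) \<le> 4 * D * (ln (4 * M) + 1)"
  proof (rule sampling[OF fin\<Omega>])
    let ?X = "Pow {..<B}"
    have finX: "finite ?X" "card ?X = 2 ^ B" by (auto simp: card_Pow)
    have HX: "H \<subseteq> sep ` (?X \<times> ?X)" by (auto simp: H_def)
    then show "finite H" by (rule finite_subset) simp
    have "card H \<le> card (sep ` (?X \<times> ?X))" using HX by (rule card_mono[rotated]) simp
    also have "\<dots> \<le> card (?X \<times> ?X)" by (rule card_image_le) simp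
    also have "\<dots> = 4 ^ B" using finX by (simp add: card_cartesian_product flip: power_mult_distrib)
    finally have "card H \<le> 4 ^ B" .
    then have "real (card H) \<le> real (4 ^ B)" by (rule of_nat_mono)
    then have H4: "real (card H) \<le> 4 ^ B" by simp
    show "real (card H) \<le> M" unfolding M_def by (rule order_trans[OF H4]) simp
    have PX: "P \<subseteq> (\<lambda>U. sep (U, {})) ` ?X \<union> (\<lambda>V. sep ({}, V)) ` ?X" by (auto simp: P_def)
    then show "finite P" by (rule finite_subset) simp
    have "card P \<le> card ((\<lambda>U. sep (U, {})) ` ?X \<union> (\<lambda>V. sep ({}, V)) ` ?X)"
      using PX by (rule card_mono[rotated]) simp
    also have "\<dots> \<le> card ((\<lambda>U. sep (U, {})) ` ?X) + card ((\<lambda>V. sep ({}, V)) ` ?X)"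
      by (rule card_Un_le)
    also have "\<dots> \<le> 2 ^ B + 2 ^ B"
      using finX card_image_le[OF finX(1)] by (metis add_mono)
    finally have "card P \<le> 2 * 2 ^ B" by simp
    then have "real (card P) \<le> real (2 * 2 ^ B)" by (rule of_nat_mono)
    also have "\<dots> = 2 * 2 ^ B" by simp
    also have "\<dots> \<le> M" unfolding M_def by (simp add: power_mono)
    finally show "real (card P) \<le> M" .
    show "h \<subseteq> \<Omega> \<and> card h = z choose x" if "h \<in> H" for h
      using that sub card_sep by (auto simp: H_def)
    show "p \<subseteq> \<Omega> \<and> real (card p) \<le> D * real (z choose x)" if "p \<in> P" for p
      using that sub card_sepU card_sepV x by (auto simp: P_def D_def)
    have "(1::real) \<le> 4 ^ B" by (rule one_le_power) simp
    then show "1 \<le> M" unfolding M_def by linarith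
    have "1 * 1 \<le> real (B + 1)^2 * exp (rate * B)"
      using rate_pos by (intro mult_mono one_le_power) auto
    then show "1 \<le> D" by (simp add: D_def)
    show "0 < z choose x" using x by simp
    \<comment> \<open>A concrete disjoint pair of sizes \<open>a\<close> and \<open>b\<close> shows
      that a hitting target fits into \<Omega>.\<close>
    have "(z choose x) = card (sep ({..<a}, {a..<a+b}))"
      using Bz by (intro card_sep[symmetric]) auto
    also have "\<dots> \<le> card \<Omega>" using sub fin\<Omega> by (intro card_mono) auto
    finally show "z choose x \<le> card \<Omega>" .
  qed blast
  have bound: "4 * D * (ln (4 * M) + 1) \<le> 8 * real (B + 2)^3 * exp (rate * B)"
  proof -
    have "4 * M = 2 ^ (2 * B + 3)" by (simp add: M_def power_add power_mult)
    then have "ln (4 * M) = real (2 * B + 3) * ln 2" by (simp add: ln_realpow)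
    also have "\<dots> \<le> real (2 * B + 3) * 1" using ln_2_less_1 by (intro mult_left_mono) auto
    finally have "ln (4 * M) + 1 \<le> 2 * real (B + 2)" by simp
    then have "4 * D * (ln (4 * M) + 1) \<le> 4 * D * (2 * real (B + 2))"
      by (intro mult_left_mono) (auto simp: D_def)
    also have "\<dots> = (8 * real (B + 2) * exp (rate * B)) * real (B + 1)^2" by (simp add: D_def)
    also have "\<dots> \<le> (8 * real (B + 2) * exp (rate * B)) * real (B + 2)^2"
      by (intro mult_left_mono power_mono) auto
    also have "\<dots> = 8 * real (B + 2)^3 * exp (rate * B)"
      by (simp only: power2_eq_square power3_eq_cube mult_ac)
    finally show ?thesis .
  qed
  show ?thesis
  proof (rule that[of F])
    fix U V assume "U \<subseteq> {..<B}" "V \<subseteq> {..<B}" "card U = a" "card V = b" "U \<inter> V = {}"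
    then have "sep (U, V) \<in> H" by (auto simp: H_def)
    from F(2)[OF this] show "\<exists>S\<in>set F. U \<subseteq> S \<and> S \<inter> V = {}" by (auto simp: sep_def)
  next
    fix U assume "U \<subseteq> {..<B}" "card U = a"
    then have "sep (U, {}) \<in> P" by (auto simp: P_def)
    from order_trans[OF F(3)[OF this] bound]
    have "real (length (filter (\<lambda>S. S \<in> sep (U, {})) F)) \<le> 8 * real (B + 2)^3 * exp (rate * B)" .
    moreover have "filter (\<lambda>S. S \<in> sep (U, {})) F = filter (\<lambda>S. U \<subseteq> S) F"
      using F(1) by (intro filter_cong) (auto simp: sep_def)
    ultimately show "real (length (filter (\<lambda>S. U \<subseteq> S) F)) \<le> 8 * real (B + 2)^3 * exp (rate * B)"
      by simp
  next
    fix V assume "V \<subseteq> {..<B}" "card V = b"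
    then have "sep ({}, V) \<in> P" by (auto simp: P_def)
    from order_trans[OF F(3)[OF this] bound]
    have "real (length (filter (\<lambda>S. S \<in> sep ({}, V)) F)) \<le> 8 * real (B + 2)^3 * exp (rate * B)" .
    moreover have "filter (\<lambda>S. S \<in> sep ({}, V)) F = filter (\<lambda>S. S \<inter> V = {}) F"
      using F(1) by (intro filter_cong) (auto simp: sep_def)
    ultimately show "real (length (filter (\<lambda>S. S \<inter> V = {}) F)) \<le> 8 * real (B + 2)^3 * exp (rate * B)"
      by simp
  qed
qed

text \<open>A set knows its own size but not that of its partner, so it takes keys from the families
  for all possible partner sizes; this costs one more factor \<open>B + 2\<close>. Each key is
  tagged with both sizes, so that a common key always stands for one separating set of one
  family.\<close>

lemma disjointness_cover:
  fixes B :: nat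
  obtains A A' :: "nat set \<Rightarrow> nat set" where
    "\<And>U. U \<subseteq> {..<B} \<Longrightarrow> finite (A U) \<and> real (card (A U)) \<le> 8 * real (B + 2)^4 * exp (rate * B)"
    "\<And>V. V \<subseteq> {..<B} \<Longrightarrow> finite (A' V) \<and> real (card (A' V)) \<le> 8 * real (B + 2)^4 * exp (rate * B)"
    "\<And>U V. U \<subseteq> {..<B} \<Longrightarrow> V \<subseteq> {..<B} \<Longrightarrow> A U \<inter> A' V \<noteq> {} \<longleftrightarrow> U \<inter> V = {}"
proof -
  define K where "K = 8 * real (B + 2)^3 * exp (rate * B)"
  define good where "good = (\<lambda>a b F.
    (\<forall>U V. U \<subseteq> {..<B} \<longrightarrow> V \<subseteq> {..<B} \<longrightarrow> card U = a \<longrightarrow> card V = b \<longrightarrow> U \<inter> V = {}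
       \<longrightarrow> (\<exists>S\<in>set F. U \<subseteq> S \<and> S \<inter> V = {})) \<and>
    (\<forall>U. U \<subseteq> {..<B} \<longrightarrow> card U = a \<longrightarrow> real (length (filter (\<lambda>S. U \<subseteq> S) F)) \<le> K) \<and>
    (\<forall>V. V \<subseteq> {..<B} \<longrightarrow> card V = b \<longrightarrow> real (length (filter (\<lambda>S. S \<inter> V = {}) F)) \<le> K))"
  have "\<exists>F. a + b \<le> B \<longrightarrow> good a b F" for a b
  proof (cases "a + b \<le> B")
    case True
    show ?thesis
    proof (rule separating_family[OF True])
      fix F :: "nat set list"
      assume
        "\<And>U V. U \<subseteq> {..<B} \<Longrightarrow> V \<subseteq> {..<B} \<Longrightarrow> card U = a \<Longrightarrow> card V = b \<Longrightarrow> U \<inter> V = {}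
           \<Longrightarrow> \<exists>S\<in>set F. U \<subseteq> S \<and> S \<inter> V = {}"
        "\<And>U. U \<subseteq> {..<B} \<Longrightarrow> card U = a
           \<Longrightarrow> real (length (filter (\<lambda>S. U \<subseteq> S) F)) \<le> 8 * real (B + 2)^3 * exp (rate * B)"
        "\<And>V. V \<subseteq> {..<B} \<Longrightarrow> card V = b
           \<Longrightarrow> real (length (filter (\<lambda>S. S \<inter> V = {}) F)) \<le> 8 * real (B + 2)^3 * exp (rate * B)"
      then have "good a b F" unfolding K_def good_def by blast
      then show ?thesis by blast
    qed
  qed simp
  then obtain F where F: "\<And>a b. a + b \<le> B \<Longrightarrow> good a b (F a b)" by metis
  have
    F1: "\<exists>S\<in>set (F a b). U \<subseteq> S \<and> S \<inter> V = {}"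
    if "a + b \<le> B" "U \<subseteq> {..<B}" "V \<subseteq> {..<B}" "card U = a" "card V = b" "U \<inter> V = {}" for a b U V
    using F[OF that(1), unfolded good_def] that(2-) by blast
  have F2: "real (length (filter (\<lambda>S. U \<subseteq> S) (F a b))) \<le> K"
    if "a + b \<le> B" "U \<subseteq> {..<B}" "card U = a" for a b U
    using F[OF that(1), unfolded good_def] that(2-) by blast
  have F3: "real (length (filter (\<lambda>S. S \<inter> V = {}) (F a b))) \<le> K"
    if "a + b \<le> B" "V \<subseteq> {..<B}" "card V = b" for a b V
    using F[OF that(1), unfolded good_def] that(2-) by blast
  define key where "key = (\<lambda>a b i. prod_encode (a, prod_encode (b, i)))"
  have key_inj: "key a b i = key a' b' i' \<longleftrightarrow> a = a' \<and> b = b' \<and> i = i'" for a b i a' b' i'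
    by (simp add: key_def)
  define IU where "IU = (\<lambda>U b. {i. i < length (F (card U) b) \<and> U \<subseteq> F (card U) b ! i})"
  define IV where "IV = (\<lambda>V a. {i. i < length (F a (card V)) \<and> F a (card V) ! i \<inter> V = {}})"
  define A where "A = (\<lambda>U. \<Union>b\<in>{..B - card U}. key (card U) b ` IU U b)"
  define A' where "A' = (\<lambda>V. \<Union>a\<in>{..B - card V}. key a (card V) ` IV V a)"
  have cardle: "card W \<le> B" if "W \<subseteq> {..<B}" for W
    using card_mono[OF _ that] by simp
  have total: "real (card (\<Union>b\<in>{..n}. J b)) \<le> 8 * real (B + 2)^4 * exp (rate * B)"
    if "n \<le> B" "\<And>b. b \<le> n \<Longrightarrow> real (card (J b)) \<le> K" for n and J :: "nat \<Rightarrow> nat set"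
  proof -
    have "real (card (\<Union>b\<in>{..n}. J b)) \<le> real (\<Sum>b\<le>n. card (J b))"
      using card_UN_le[of "{..n}" J] by (intro of_nat_mono) simp
    also have "\<dots> \<le> (\<Sum>b\<le>n. K)" unfolding of_nat_sum using that by (intro sum_mono) auto
    also have "\<dots> = real (n + 1) * K" by simp
    also have "\<dots> \<le> real (B + 2) * K" using that by (intro mult_right_mono) (auto simp: K_def)
    also have "\<dots> = 8 * real (B + 2)^4 * exp (rate * B)"
      by (simp add: K_def power3_eq_cube power4_eq_xxxx)
    finally show ?thesis .
  qed
  show ?thesis
  proof (rule that[of A A'])
    fix U assume U: "U \<subseteq> {..<B}"
    have "real (card (key (card U) b ` IU U b)) \<le> K" if "b \<le> B - card U" for b
    proof -
      have "card (key (card U) b ` IU U b) \<le> card (IU U b)"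
        by (rule card_image_le) (simp add: IU_def)
      also have "\<dots> = length (filter (\<lambda>S. U \<subseteq> S) (F (card U) b))"
        by (simp add: IU_def length_filter_conv_card)
      finally have "real (card (key (card U) b ` IU U b))
          \<le> real (length (filter (\<lambda>S. U \<subseteq> S) (F (card U) b)))" by simp
      also have "\<dots> \<le> K" using F2[of "card U" b U] U that cardle[OF U] by simp
      finally show ?thesis .
    qed
    then show "finite (A U) \<and> real (card (A U)) \<le> 8 * real (B + 2)^4 * exp (rate * B)"
      unfolding A_def using total[of "B - card U"] by (simp add: IU_def)
  next
    fix V assume V: "V \<subseteq> {..<B}"
    have "real (card (key a (card V) ` IV V a)) \<le> K" if "a \<le> B - card V" for a
    proof -
      have "card (key a (card V) ` IV V a) \<le> card (IV V a)"
        by (rule card_image_le) (simp add: IV_def)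
      also have "\<dots> = length (filter (\<lambda>S. S \<inter> V = {}) (F a (card V)))"
        by (simp add: IV_def length_filter_conv_card)
      finally have "real (card (key a (card V) ` IV V a))
          \<le> real (length (filter (\<lambda>S. S \<inter> V = {}) (F a (card V))))" by simp
      also have "\<dots> \<le> K" using F3[of a "card V" V] V that cardle[OF V] by simp
      finally show ?thesis .
    qed
    then show "finite (A' V) \<and> real (card (A' V)) \<le> 8 * real (B + 2)^4 * exp (rate * B)"
      unfolding A'_def using total[of "B - card V"] by (simp add: IV_def)
  next
    fix U V assume U: "U \<subseteq> {..<B}" and V: "V \<subseteq> {..<B}"
    show "A U \<inter> A' V \<noteq> {} \<longleftrightarrow> U \<inter> V = {}"
    proof
      assume "A U \<inter> A' V \<noteq> {}"
      then obtain i where "i \<in> IU U (card V)" "i \<in> IV V (card U)"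
        by (auto simp: A_def A'_def key_inj)
      then show "U \<inter> V = {}" by (auto simp: IU_def IV_def)
    next
      assume disj: "U \<inter> V = {}"
      have fin: "finite U" "finite V" using U V finite_subset by blast+
      have "card U + card V = card (U \<union> V)" using disj fin by (simp add: card_Un_disjoint)
      also have "\<dots> \<le> B" using cardle[of "U \<union> V"] U V by simp
      finally have le: "card U + card V \<le> B" .
      then obtain S where "S \<in> set (F (card U) (card V))" "U \<subseteq> S" "S \<inter> V = {}"
        using F1[OF le U V] disj by blast
      then obtain i where "i \<in> IU U (card V)" "i \<in> IV V (card U)"
        by (auto simp: IU_def IV_def in_set_conv_nth)
      then have "key (card U) (card V) i \<in> A U" "key (card U) (card V) i \<in> A' V"
        using le unfolding A_def A'_def by auto
      then show "A U \<inter> A' V \<noteq> {}" by blast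
    qed
  qed
qed

text \<open>Since \<open>rate\<close> is below \<open>ln 1.155\<close>, the gain is exponential in
  \<open>B\<close> and outgrows all polynomial losses collected so far.\<close>

lemma block_size:
  obtains B :: nat where "1 \<le> B" "8 * real (B + 2)^4 * exp (rate * B) \<le> 1.155 ^ B"
proof -
  define \<epsilon> where "\<epsilon> = ln 1.155 - rate"
  have \<epsilon>: "0 < \<epsilon>"
    using exp_rate_less ln_less_cancel_iff[of "exp rate" "1.155"] by (simp add: \<epsilon>_def)
  have "((\<lambda>n. (\<epsilon> * real n) ^ 4 / exp (\<epsilon> * real n)) \<longlongrightarrow> 0) sequentially"
    by (rule filterlim_compose[OF tendsto_power_div_exp_0])
       (rule filterlim_tendsto_pos_mult_at_top[OF tendsto_const \<epsilon> filterlim_real_sequentially])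
  \<comment> \<open>Here 648 is \<open>8 * 3 ^ 4\<close>, in view of
    \<open>B + 2 \<le> 3 * B\<close>.\<close>
  then have "\<forall>\<^sub>F n in sequentially. (\<epsilon> * real n) ^ 4 / exp (\<epsilon> * real n) < \<epsilon>^4 / 648"
    by (rule order_tendstoD) (use \<epsilon> in simp)
  then have "\<forall>\<^sub>F n in sequentially. 1 \<le> n \<and> (\<epsilon> * real n) ^ 4 / exp (\<epsilon> * real n) < \<epsilon>^4 / 648"
    by (intro eventually_conj eventually_ge_at_top)
  then obtain B where B: "1 \<le> B" "(\<epsilon> * real B) ^ 4 / exp (\<epsilon> * real B) < \<epsilon>^4 / 648"
    unfolding eventually_sequentially by blast
  have "\<epsilon>^4 * (648 * real B ^ 4) \<le> \<epsilon>^4 * exp (\<epsilon> * real B)"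
    using B(2) by (simp add: field_simps)
  then have "648 * real B ^ 4 \<le> exp (\<epsilon> * real B)" using \<epsilon> by simp
  moreover have "real (B + 2) ^ 4 \<le> (3 * real B) ^ 4" using B by (intro power_mono) auto
  ultimately have "8 * real (B + 2)^4 \<le> exp (\<epsilon> * real B)" by (simp add: power_mult_distrib)
  then have "8 * real (B + 2)^4 * exp (rate * B) \<le> exp (\<epsilon> * real B) * exp (rate * B)"
    by (intro mult_right_mono) auto
  also have "\<dots> = exp (real B * ln 1.155)" by (simp add: \<epsilon>_def algebra_simps flip: exp_add)
  also have "\<dots> = 1.155 ^ B" by (subst exp_of_nat_mult) simp
  finally show ?thesis using B(1) that by blast
qed

section \<open>Keys\<close>

text \<open>New digits enter at the low end, so a program extends the number by one multiplication
  and one addition without storing powers of \<open>R\<close>. The digit with index 0 thus ends up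
  as the most significant one.\<close>

fun horner :: "nat \<Rightarrow> (nat \<Rightarrow> nat) \<Rightarrow> nat \<Rightarrow> nat" where
  "horner R \<beta> 0 = 0"
| "horner R \<beta> (Suc k) = R * horner R \<beta> k + \<beta> k"

lemma horner_digit:
  assumes "\<And>j. j < k \<Longrightarrow> \<beta> j < R" "j < k"
  shows "horner R \<beta> k div R ^ (k - 1 - j) mod R = \<beta> j"
  using assms
proof (induction k)
  case (Suc k)
  have R: "0 < R" using Suc.prems(1)[of k] by simp
  show ?case
  proof (cases "j = k")
    case True
    then show ?thesis using Suc.prems(1)[of k] by simp
  next
    case False
    then have jk: "j < k" using Suc.prems by simp
    then have "Suc k - 1 - j = Suc (k - 1 - j)" by simp
    moreover have "horner R \<beta> (Suc k) div R = horner R \<beta> k"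
      using Suc.prems(1)[of k] R by simp
    ultimately have "horner R \<beta> (Suc k) div R ^ (Suc k - 1 - j) = horner R \<beta> k div R ^ (k - 1 - j)"
      by (simp only: power_Suc div_mult2_eq)
    then show ?thesis using Suc.IH Suc.prems jk by simp
  qed
qed simp

lemma horner_less:
  assumes "\<And>j. j < k \<Longrightarrow> \<beta> j < R"
  shows "horner R \<beta> k < R ^ k"
  using assms
proof (induction k)
  case (Suc k)
  then have "horner R \<beta> k + 1 \<le> R ^ k" "\<beta> k < R" by auto
  then have "R * (horner R \<beta> k + 1) \<le> R * R ^ k" by (intro mult_left_mono) auto
  then show ?case using \<open>\<beta> k < R\<close> by simp
qed simp

lemma horner_cong:
  assumes "\<And>j. j < k \<Longrightarrow> \<beta> j = \<gamma> j"
  shows "horner R \<beta> k = horner R \<gamma> k"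
  using assms by (induction k) auto

lemma horner_eq_iff:
  assumes "\<And>j. j < k \<Longrightarrow> \<beta> j < R" "\<And>j. j < k \<Longrightarrow> \<gamma> j < R"
  shows "horner R \<beta> k = horner R \<gamma> k \<longleftrightarrow> (\<forall>j<k. \<beta> j = \<gamma> j)"
  using horner_digit[of k \<beta> R] horner_digit[of k \<gamma> R] horner_cong[of k \<beta> \<gamma> R] assms by metis

text \<open>Here index 0 is the least significant digit, opposite to \<open>horner\<close>, because
  the choices encoded in \<open>e\<close> are taken off by repeated division.\<close>

lemma exists_digits:
  assumes "\<And>j. j < k \<Longrightarrow> \<delta> j < (D::nat)"
  shows "\<exists>e<D ^ k. \<forall>j<k. e div D ^ j mod D = \<delta> j"
  using assms
proof (induction k arbitrary: \<delta>)
  case (Suc k)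
  obtain e where e: "e < D ^ k" "\<forall>j<k. e div D ^ j mod D = \<delta> (Suc j)"
    using Suc.IH[of "\<lambda>j. \<delta> (Suc j)"] Suc.prems by auto
  have d0: "\<delta> 0 < D" using Suc.prems[of 0] by simp
  have "D * (e + 1) \<le> D * D ^ k" using e by (intro mult_left_mono) auto
  then have "D * e + \<delta> 0 < D ^ Suc k" using d0 by simp
  moreover have "(D * e + \<delta> 0) div D ^ j mod D = \<delta> j" if "j < Suc k" for j
  proof (cases j)
    case (Suc i)
    have "(D * e + \<delta> 0) div D = e" using d0 by simp
    then have "(D * e + \<delta> 0) div D ^ j = e div D ^ i"
      unfolding Suc power_Suc div_mult2_eq by simp
    then show ?thesis using e that Suc by simp
  qed (use d0 in simp)
  ultimately show ?case by blast
qed simp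

section \<open>Symbol tables for one block\<close>

text \<open>Padding each key set to exactly \<Delta> entries lets the numbers below \<Delta> ^ k
  enumerate the choices in \<open>k\<close> blocks, whatever the vector is. Indexing by the code of
  a bit string instead of a set turns the cover into finite numerical tables.\<close>

lemma block_tables:
  obtains B \<Delta> R :: nat and T T' :: "nat \<Rightarrow> nat \<Rightarrow> nat" where
    "1 \<le> B" "1 \<le> \<Delta>" "real \<Delta> \<le> 1.155 ^ B"
    "\<And>w g. T w g < R" "\<And>w g. T' w g < R"
    "\<And>\<beta> \<gamma>. (\<And>j. j < B \<Longrightarrow> \<beta> j < 2) \<Longrightarrow> (\<And>j. j < B \<Longrightarrow> \<gamma> j < 2) \<Longrightarrow>
       (\<exists>g<\<Delta>. \<exists>g'<\<Delta>. T (horner 2 \<beta> B) g = T' (horner 2 \<gamma> B) g')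
         \<longleftrightarrow> (\<forall>j<B. \<beta> j = 0 \<or> \<gamma> j = 0)"
proof -
  obtain B where B: "1 \<le> B" "8 * real (B + 2)^4 * exp (rate * B) \<le> 1.155 ^ B"
    by (rule block_size)
  define \<Delta> where "\<Delta> = nat \<lfloor>(1.155::real) ^ B\<rfloor>"
  have ge1: "(1::real) \<le> 1.155 ^ B" by (rule one_le_power) simp
  then have \<Delta>1: "1 \<le> \<Delta>" unfolding \<Delta>_def by (simp add: le_nat_floor)
  have \<Delta>le: "real \<Delta> \<le> 1.155 ^ B" unfolding \<Delta>_def using ge1 by (simp add: of_nat_floor)
  obtain A A' :: "nat set \<Rightarrow> nat set" where
    A: "\<And>U. U \<subseteq> {..<B} \<Longrightarrow> finite (A U) \<and> real (card (A U)) \<le> 8 * real (B + 2)^4 * exp (rate * B)" and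
    A': "\<And>V. V \<subseteq> {..<B} \<Longrightarrow> finite (A' V) \<and> real (card (A' V)) \<le> 8 * real (B + 2)^4 * exp (rate * B)" and
    cover: "\<And>U V. U \<subseteq> {..<B} \<Longrightarrow> V \<subseteq> {..<B} \<Longrightarrow> A U \<inter> A' V \<noteq> {} \<longleftrightarrow> U \<inter> V = {}"
    by (rule disjointness_cover[of B]) blast
  have cardA: "finite (A U)" "card (A U) \<le> \<Delta>" if "U \<subseteq> {..<B}" for U
    using A[OF that] B(2) unfolding \<Delta>_def by (auto intro!: le_nat_floor)
  have cardA': "finite (A' U)" "card (A' U) \<le> \<Delta>" if "U \<subseteq> {..<B}" for U
    using A'[OF that] B(2) unfolding \<Delta>_def by (auto intro!: le_nat_floor)
  have "finite (\<Union>U\<in>Pow {..<B}. A U \<union> A' U)" using cardA cardA' by auto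
  then obtain r where r: "\<And>U s. U \<subseteq> {..<B} \<Longrightarrow> s \<in> A U \<union> A' U \<Longrightarrow> s < r"
    unfolding finite_nat_set_iff_bounded by blast
  \<comment> \<open>This inverts the block code: \<open>horner\<close> gives bit \<open>j\<close>
    the weight \<open>2 ^ (B - 1 - j)\<close>.\<close>
  define dec where "dec = (\<lambda>w. {j. j < B \<and> w div 2 ^ (B - 1 - j) mod 2 = (1::nat)})"
  define tab where "tab = (\<lambda>(A :: nat set \<Rightarrow> nat set) pad w g.
    let xs = sorted_list_of_set (A (dec w)) in if g < length xs then xs ! g else (pad::nat))"
  have dec_sub: "dec w \<subseteq> {..<B}" for w by (auto simp: dec_def)
  have dec_horner: "dec (horner 2 \<beta> B) = {j. j < B \<and> \<beta> j = 1}"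
    if "\<And>j. j < B \<Longrightarrow> \<beta> j < 2" for \<beta>
    using horner_digit[of B \<beta> 2] that by (auto simp: dec_def)
  have tab_less: "tab F pad w g < r + 2"
    if "pad < r + 2" "\<And>U. U \<subseteq> {..<B} \<Longrightarrow> finite (F U)" "\<And>U s. U \<subseteq> {..<B} \<Longrightarrow> s \<in> F U \<Longrightarrow> s < r"
    for F pad w g
  proof (cases "g < length (sorted_list_of_set (F (dec w)))")
    case True
    then have "sorted_list_of_set (F (dec w)) ! g \<in> F (dec w)"
      using nth_mem[OF True] that(2)[OF dec_sub] by simp
    from that(3)[OF dec_sub this] have "sorted_list_of_set (F (dec w)) ! g < r + 2" by simp
    then show ?thesis using True by (simp add: tab_def)
  qed (use that in \<open>simp add: tab_def\<close>)
  have tab_range: "(\<exists>g<\<Delta>. tab F pad w g = s) \<longleftrightarrow> s \<in> F (dec w)"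
    if "finite (F (dec w))" "card (F (dec w)) \<le> \<Delta>" "s \<noteq> pad" for F pad w s
  proof
    assume "\<exists>g<\<Delta>. tab F pad w g = s"
    then obtain g where "tab F pad w g = s" by blast
    then have "g < length (sorted_list_of_set (F (dec w)))" "sorted_list_of_set (F (dec w)) ! g = s"
      using that(3) by (auto simp: tab_def Let_def split: if_splits)
    then have "s \<in> set (sorted_list_of_set (F (dec w)))" using nth_mem by blast
    then show "s \<in> F (dec w)" using that(1) by simp
  next
    assume "s \<in> F (dec w)"
    then have "s \<in> set (sorted_list_of_set (F (dec w)))" using that(1) by simp
    then obtain g where "g < length (sorted_list_of_set (F (dec w)))" "sorted_list_of_set (F (dec w)) ! g = s"
      by (meson in_set_conv_nth)
    then show "\<exists>g<\<Delta>. tab F pad w g = s"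
      using that(2) by (intro exI[of _ g]) (auto simp: tab_def)
  qed
  have pad_not: "r \<notin> A' U" "r + 1 \<notin> A U" if "U \<subseteq> {..<B}" for U
    using r[OF that] by (meson UnI2 less_irrefl, meson UnI1 not_add_less1)
  \<comment> \<open>The two tables are padded with different symbols, so that padding never causes a match.\<close>
  define T where "T = tab A r"
  define T' where "T' = tab A' (r + 1)"
  show ?thesis
  proof (rule that[of B \<Delta> T "r + 2" T'])
    show "T w g < r + 2" for w g unfolding T_def by (rule tab_less) (use cardA r in auto)
    show "T' w g < r + 2" for w g unfolding T'_def by (rule tab_less) (use cardA' r in auto)
    fix \<beta> \<gamma> :: "nat \<Rightarrow> nat"
    assume \<beta>: "\<And>j. j < B \<Longrightarrow> \<beta> j < 2" and \<gamma>: "\<And>j. j < B \<Longrightarrow> \<gamma> j < 2"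
    let ?w = "horner 2 \<beta> B" and ?w' = "horner 2 \<gamma> B"
    have R: "(\<exists>g<\<Delta>. T ?w g = s) \<longleftrightarrow> s \<in> A (dec ?w)" if "s \<noteq> r" for s
      unfolding T_def using tab_range[of A ?w s r] cardA[OF dec_sub] that by blast
    have R': "(\<exists>g<\<Delta>. T' ?w' g = s) \<longleftrightarrow> s \<in> A' (dec ?w')" if "s \<noteq> r + 1" for s
      unfolding T'_def using tab_range[of A' ?w' s "r + 1"] cardA'[OF dec_sub] that by blast
    have "(\<exists>g<\<Delta>. \<exists>g'<\<Delta>. T ?w g = T' ?w' g')
        \<longleftrightarrow> (\<exists>s. (\<exists>g<\<Delta>. T ?w g = s) \<and> (\<exists>g<\<Delta>. T' ?w' g = s))" by metis
    also have "\<dots> \<longleftrightarrow> (\<exists>s. s \<in> A (dec ?w) \<and> s \<in> A' (dec ?w'))"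
    proof (rule iff_exI)
      fix s
      consider "s = r" | "s = r + 1" | "s \<noteq> r" "s \<noteq> r + 1" by blast
      then show "((\<exists>g<\<Delta>. T ?w g = s) \<and> (\<exists>g<\<Delta>. T' ?w' g = s)) = (s \<in> A (dec ?w) \<and> s \<in> A' (dec ?w'))"
      proof cases
        case 1
        then show ?thesis using R'[of s] pad_not(1)[OF dec_sub] by simp
      next
        case 2
        then show ?thesis using R[of s] pad_not(2)[OF dec_sub] by simp
      next
        case 3
        then show ?thesis using R R' by simp
      qed
    qed
    also have "\<dots> \<longleftrightarrow> A (dec ?w) \<inter> A' (dec ?w') \<noteq> {}" by blast
    also have "\<dots> \<longleftrightarrow> dec ?w \<inter> dec ?w' = {}" by (rule cover[OF dec_sub dec_sub])
    also have "\<dots> \<longleftrightarrow> (\<forall>j<B. \<beta> j = 0 \<or> \<gamma> j = 0)"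
    proof -
      have d: "dec ?w = {j. j < B \<and> \<beta> j = 1}" by (rule dec_horner) (rule \<beta>)
      have d': "dec ?w' = {j. j < B \<and> \<gamma> j = 1}" by (rule dec_horner) (rule \<gamma>)
      have bits: "j < B \<Longrightarrow> \<beta> j \<noteq> 0 \<longleftrightarrow> \<beta> j = 1" "j < B \<Longrightarrow> \<gamma> j \<noteq> 0 \<longleftrightarrow> \<gamma> j = 1" for j
        using \<beta>[of j] \<gamma>[of j] by linarith+
      have "dec ?w \<inter> dec ?w' = {} \<longleftrightarrow> (\<forall>j<B. \<not> (\<beta> j = 1 \<and> \<gamma> j = 1))"
        unfolding d d' by auto
      also have "\<dots> \<longleftrightarrow> (\<forall>j<B. \<not> (\<beta> j \<noteq> 0 \<and> \<gamma> j \<noteq> 0))"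
        by (rule all_cong) (simp only: bits)
      finally show ?thesis by simp
    qed
    finally show "(\<exists>g<\<Delta>. \<exists>g'<\<Delta>. T ?w g = T' ?w' g') \<longleftrightarrow> (\<forall>j<B. \<beta> j = 0 \<or> \<gamma> j = 0)" .
  qed (use B \<Delta>1 \<Delta>le in auto)
qed

definition block_code :: "nat \<Rightarrow> (nat \<Rightarrow> nat) \<Rightarrow> nat \<Rightarrow> nat" where
  "block_code B \<beta> m = horner 2 (\<lambda>j. \<beta> (m * B + j)) B"

text \<open>
  The base \<open>\<Delta>\<close> digits of \<open>e\<close> choose one of the \<open>\<Delta>\<close> candidates in each block; the chosen symbols
  are the base \<open>R\<close> digits of the key.
\<close>

definition key :: "(nat \<Rightarrow> nat \<Rightarrow> nat) \<Rightarrow> nat \<Rightarrow> nat \<Rightarrow> nat \<Rightarrow> (nat \<Rightarrow> nat) \<Rightarrow> nat \<Rightarrow> nat \<Rightarrow> nat" where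
  "key T B \<Delta> R \<beta> e = horner R (\<lambda>m. T (block_code B \<beta> m) (e div \<Delta> ^ m mod \<Delta>))"

text \<open>Keys agree iff all their digits agree, and the choices in different blocks are
  independent. So matching choices found block by block can be packed into single numbers
  \<open>e\<close> and \<open>e'\<close> by \<open>exists_digits\<close>.\<close>

lemma key_match_iff:
  assumes "1 \<le> B" "1 \<le> \<Delta>" "\<And>w g. T w g < R" "\<And>w g. T' w g < R"
    and tables: "\<And>\<beta> \<gamma>. (\<And>j. j < B \<Longrightarrow> \<beta> j < 2) \<Longrightarrow> (\<And>j. j < B \<Longrightarrow> \<gamma> j < 2) \<Longrightarrow>
       (\<exists>g<\<Delta>. \<exists>g'<\<Delta>. T (horner 2 \<beta> B) g = T' (horner 2 \<gamma> B) g')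
         \<longleftrightarrow> (\<forall>j<B. \<beta> j = 0 \<or> \<gamma> j = 0)"
    and \<beta>: "\<And>j. \<beta> j < 2" and \<gamma>: "\<And>j. \<gamma> j < 2"
  shows "(\<exists>e<\<Delta> ^ k. \<exists>e'<\<Delta> ^ k. key T B \<Delta> R \<beta> e k = key T' B \<Delta> R \<gamma> e' k)
    \<longleftrightarrow> (\<forall>i<k * B. \<beta> i = 0 \<or> \<gamma> i = 0)"
proof -
  have block: "(\<exists>g<\<Delta>. \<exists>g'<\<Delta>. T (block_code B \<beta> m) g = T' (block_code B \<gamma> m) g')
      \<longleftrightarrow> (\<forall>j<B. \<beta> (m * B + j) = 0 \<or> \<gamma> (m * B + j) = 0)" for m
    unfolding block_code_def by (rule tables) (use \<beta> \<gamma> in auto)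
  have key_eq: "key T B \<Delta> R \<beta> e k = key T' B \<Delta> R \<gamma> e' k \<longleftrightarrow> (\<forall>m<k.
      T (block_code B \<beta> m) (e div \<Delta> ^ m mod \<Delta>) = T' (block_code B \<gamma> m) (e' div \<Delta> ^ m mod \<Delta>))"
    for e e'
    unfolding key_def by (rule horner_eq_iff) (rule assms(3), rule assms(4))
  have "(\<exists>e<\<Delta> ^ k. \<exists>e'<\<Delta> ^ k. key T B \<Delta> R \<beta> e k = key T' B \<Delta> R \<gamma> e' k)
      \<longleftrightarrow> (\<exists>e<\<Delta> ^ k. \<exists>e'<\<Delta> ^ k. \<forall>m<k.
        T (block_code B \<beta> m) (e div \<Delta> ^ m mod \<Delta>) = T' (block_code B \<gamma> m) (e' div \<Delta> ^ m mod \<Delta>))"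
    unfolding key_eq ..
  also have "\<dots> \<longleftrightarrow> (\<forall>m<k. \<exists>g<\<Delta>. \<exists>g'<\<Delta>. T (block_code B \<beta> m) g = T' (block_code B \<gamma> m) g')"
    (is "?L \<longleftrightarrow> ?R")
  proof
    have less: "x mod \<Delta> < \<Delta>" for x using \<open>1 \<le> \<Delta>\<close> by simp
    assume ?L
    then obtain e e' where e: "\<And>m. m < k \<Longrightarrow> T (block_code B \<beta> m) (e div \<Delta> ^ m mod \<Delta>)
        = T' (block_code B \<gamma> m) (e' div \<Delta> ^ m mod \<Delta>)" by blast
    show ?R
    proof (intro allI impI)
      fix m assume "m < k"
      then show "\<exists>g<\<Delta>. \<exists>g'<\<Delta>. T (block_code B \<beta> m) g = T' (block_code B \<gamma> m) g'"
        using e less by (intro exI[of _ "e div \<Delta> ^ m mod \<Delta>"] exI[of _ "e' div \<Delta> ^ m mod \<Delta>"] conjI)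
    qed
  next
    assume ?R
    then obtain g g' where g: "\<And>m. m < k \<Longrightarrow> g m < \<Delta> \<and> g' m < \<Delta> \<and>
        T (block_code B \<beta> m) (g m) = T' (block_code B \<gamma> m) (g' m)" by metis
    obtain e where "e < \<Delta> ^ k" "\<forall>m<k. e div \<Delta> ^ m mod \<Delta> = g m"
      using exists_digits[of k g \<Delta>] g by blast
    moreover obtain e' where "e' < \<Delta> ^ k" "\<forall>m<k. e' div \<Delta> ^ m mod \<Delta> = g' m"
      using exists_digits[of k g' \<Delta>] g by blast
    ultimately show ?L using g by (intro exI[of _ e] exI[of _ e'] conjI) auto
  qed
  also have "\<dots> \<longleftrightarrow> (\<forall>m<k. \<forall>j<B. \<beta> (m * B + j) = 0 \<or> \<gamma> (m * B + j) = 0)"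
    unfolding block ..
  also have "\<dots> \<longleftrightarrow> (\<forall>i<k * B. \<beta> i = 0 \<or> \<gamma> i = 0)"
  proof safe
    fix i assume h: "\<forall>m<k. \<forall>j<B. \<beta> (m * B + j) = 0 \<or> \<gamma> (m * B + j) = 0"
      and i: "i < k * B" "0 < \<gamma> i"
    have "i div B < k" by (rule less_mult_imp_div_less) (rule i(1))
    moreover have "i mod B < B" using \<open>1 \<le> B\<close> by simp
    ultimately have "\<beta> (i div B * B + i mod B) = 0 \<or> \<gamma> (i div B * B + i mod B) = 0"
      by (rule h[rule_format])
    then have "\<beta> i = 0 \<or> \<gamma> i = 0" by (simp only: div_mult_mod_eq)
    with i(2) show "\<beta> i = 0" by auto
  next
    fix m j assume h: "\<forall>i<k * B. \<beta> i = 0 \<or> \<gamma> i = 0"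
      and mj: "m < k" "j < B" "0 < \<gamma> (m * B + j)"
    have "m * B + j < Suc m * B" using mj by simp
    also have "\<dots> \<le> k * B" using mj by (intro mult_right_mono) auto
    finally have "\<beta> (m * B + j) = 0 \<or> \<gamma> (m * B + j) = 0" by (rule h[rule_format])
    then show "\<beta> (m * B + j) = 0" using mj by simp
  qed
  finally show ?thesis .
qed

section \<open>Program logic\<close>

fun fits :: "nat \<Rightarrow> operand \<Rightarrow> state \<Rightarrow> bool" where
  "fits L x s \<longleftrightarrow> val x s < 2 ^ L"

fun test_fits :: "nat \<Rightarrow> test \<Rightarrow> state \<Rightarrow> bool" where
  "test_fits L (Eq x y) s \<longleftrightarrow> fits L x s \<and> fits L y s"
| "test_fits L (Less x y) s \<longleftrightarrow> fits L x s \<and> fits L y s"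

text \<open>Every step whose operands are below \<open>2 ^ L\<close> costs at most \<open>2 * L + 1\<close>.\<close>

definition runs :: "nat \<Rightarrow> com \<Rightarrow> state \<Rightarrow> (state \<Rightarrow> bool) \<Rightarrow> nat \<Rightarrow> bool" where
  "runs L c s Q k \<longleftrightarrow> (\<exists>t s'. exec c s t s' \<and> Q s' \<and> t \<le> k * (2 * L + 1))"

text \<open>Only loop-free code is covered; loops are treated by counted invariants in
  \<open>runs_While\<close>. The conditions \<open>fits\<close> are what allows a number of steps to
  be turned into logarithmic cost.\<close>

fun wp :: "nat \<Rightarrow> com \<Rightarrow> (state \<Rightarrow> bool) \<Rightarrow> state \<Rightarrow> bool" where
  "wp L Skip Q s \<longleftrightarrow> Q s"
| "wp L (Move r x) Q s \<longleftrightarrow> fits L x s \<and> Q (set_reg r (val x s) s)"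
| "wp L (Arith r f x y) Q s \<longleftrightarrow>
     fits L x s \<and> fits L y s \<and> Q (set_reg r (arith_val f (val x s) (val y s)) s)"
| "wp L (Load r x) Q s \<longleftrightarrow>
     fits L x s \<and> mem s (val x s) < 2 ^ L \<and> Q (set_reg r (mem s (val x s)) s)"
| "wp L (Store x y) Q s \<longleftrightarrow> fits L x s \<and> fits L y s \<and> Q (set_mem (val x s) (val y s) s)"
| "wp L (Seq c1 c2) Q s \<longleftrightarrow> wp L c1 (wp L c2 Q) s"
| "wp L (If b c1 c2) Q s \<longleftrightarrow>
     test_fits L b s \<and> (if test_val b s then wp L c1 Q s else wp L c2 Q s)"
| "wp L (While b c) Q s \<longleftrightarrow> False"

fun steps :: "com \<Rightarrow> nat" where
  "steps (Seq c1 c2) = steps c1 + steps c2"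
| "steps (If b c1 c2) = 1 + max (steps c1) (steps c2)"
| "steps _ = 1"

lemma floorlog_le_if_less: "a < 2 ^ L \<Longrightarrow> floorlog 2 a \<le> L"
  by (simp add: floorlog_leI)

lemma cost_le:
  assumes "a < 2 ^ L" "b < 2 ^ L"
  shows "cost1 a \<le> 2 * L + 1" "cost2 a b \<le> 2 * L + 1"
  using floorlog_le_if_less[OF assms(1)] floorlog_le_if_less[OF assms(2)]
  by (auto simp: cost1_def cost2_def)

lemma test_cost_le: "test_fits L b s \<Longrightarrow> test_cost b s \<le> 2 * L + 1"
  by (cases b) (auto dest: cost_le(2))

lemma runs_mono:
  assumes "runs L c s Q k" "\<And>s'. Q s' \<Longrightarrow> Q' s'" "k \<le> k'"
  shows "runs L c s Q' k'"
proof -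
  have "k * (2 * L + 1) \<le> k' * (2 * L + 1)" using assms(3) by (rule mult_right_mono) simp
  then show ?thesis using assms(1,2) order_trans unfolding runs_def by blast
qed

lemma runs_Seq:
  assumes "runs L c1 s P k1" "\<And>s'. P s' \<Longrightarrow> runs L c2 s' Q k2"
  shows "runs L (Seq c1 c2) s Q (k1 + k2)"
proof -
  obtain t1 s1 where 1: "exec c1 s t1 s1" "P s1" "t1 \<le> k1 * (2 * L + 1)"
    using assms(1) by (auto simp: runs_def)
  obtain t2 s2 where 2: "exec c2 s1 t2 s2" "Q s2" "t2 \<le> k2 * (2 * L + 1)"
    using assms(2)[OF 1(2)] by (auto simp: runs_def)
  have "t1 + t2 \<le> (k1 + k2) * (2 * L + 1)" using 1 2 unfolding distrib_right by linarith
  then show ?thesis using exec.Seq[OF 1(1) 2(1)] 2(2) unfolding runs_def by blast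
qed

lemma wp_runs: "wp L c Q s \<Longrightarrow> runs L c s Q (steps c)"
proof (induction c arbitrary: Q s)
  case Skip
  then show ?case using exec.Skip by (fastforce simp: runs_def)
next
  case (Move r x)
  then show ?case using exec.Move[of r x s] cost_le by (fastforce simp: runs_def)
next
  case (Arith r f x y)
  then show ?case using exec.Arith[of r f x y s] cost_le by (fastforce simp: runs_def)
next
  case (Load r x)
  then show ?case using exec.Load[of r x s] cost_le by (fastforce simp: runs_def)
next
  case (Store x y)
  then show ?case using exec.Store[of x y s] cost_le by (fastforce simp: runs_def)
next
  case (Seq c1 c2)
  have "runs L c1 s (wp L c2 Q) (steps c1)" using Seq by simp
  then have "runs L (Seq c1 c2) s Q (steps c1 + steps c2)"
    by (rule runs_Seq) (rule Seq.IH(2))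
  then show ?case by simp
next
  case (If b c1 c2)
  have cost: "test_cost b s \<le> 2 * L + 1" using If.prems by (intro test_cost_le) simp
  show ?case
  proof (cases "test_val b s")
    case True
    then have "runs L c1 s Q (max (steps c1) (steps c2))"
      using If.prems by (intro runs_mono[OF If.IH(1)]) auto
    then obtain t s' where t: "exec c1 s t s'" "Q s'" "t \<le> max (steps c1) (steps c2) * (2 * L + 1)"
      unfolding runs_def by blast
    have "test_cost b s + t \<le> (1 + max (steps c1) (steps c2)) * (2 * L + 1)"
      unfolding distrib_right[of 1] using cost t(3) by (intro add_mono) auto
    then show ?thesis
      using exec.IfTrue[OF True t(1)] t(2) unfolding runs_def steps.simps by blast
  next
    case False
    then have "runs L c2 s Q (max (steps c1) (steps c2))"
      using If.prems by (intro runs_mono[OF If.IH(2)]) auto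
    then obtain t s' where t: "exec c2 s t s'" "Q s'" "t \<le> max (steps c1) (steps c2) * (2 * L + 1)"
      unfolding runs_def by blast
    have "test_cost b s + t \<le> (1 + max (steps c1) (steps c2)) * (2 * L + 1)"
      unfolding distrib_right[of 1] using cost t(3) by (intro add_mono) auto
    then show ?thesis
      using exec.IfFalse[OF False t(1)] t(2) unfolding runs_def steps.simps by blast
  qed
qed simp

text \<open>The invariant carries the number of iterations and \<open>N\<close> is known in advance,
  so termination and time come out together: \<open>N\<close> bodies and \<open>N + 1\<close>
  tests.\<close>

lemma runs_While:
  assumes step: "\<And>i s. i < N \<Longrightarrow> I i s \<Longrightarrow>
      test_val b s \<and> test_fits L b s \<and> runs L c s (I (Suc i)) k"
    and stop: "\<And>s. I N s \<Longrightarrow> \<not> test_val b s \<and> test_fits L b s"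
    and init: "I 0 s"
  shows "runs L (While b c) s (I N) (N * (k + 1) + 1)"
proof -
  have "runs L (While b c) s (I N) ((N - i) * (k + 1) + 1)" if "i \<le> N" "I i s" for i s
    using that
  proof (induction "N - i" arbitrary: i s)
    case 0
    then have "I N s" by simp
    then show ?case
      using exec.WhileFalse[of b s c] stop[of s] test_cost_le unfolding runs_def by force
  next
    case (Suc m)
    then have iN: "i < N" and m: "m = N - Suc i" by auto
    have b: "test_val b s" "test_cost b s \<le> 2 * L + 1" and "runs L c s (I (Suc i)) k"
      using step[OF iN Suc.prems(2)] test_cost_le by auto
    then obtain t s1 where 1: "exec c s t s1" "I (Suc i) s1" "t \<le> k * (2 * L + 1)"
      by (auto simp: runs_def)
    obtain t2 s2 where 2: "exec (While b c) s1 t2 s2" "I N s2" "t2 \<le> (m * (k + 1) + 1) * (2 * L + 1)"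
      using Suc.hyps(1)[OF m _ 1(2)] iN unfolding runs_def m by auto
    have "test_cost b s + t + t2 \<le> (2 * L + 1) + k * (2 * L + 1) + (m * (k + 1) + 1) * (2 * L + 1)"
      using b 1(3) 2(3) by (intro add_mono)
    also have "\<dots> = (Suc m * (k + 1) + 1) * (2 * L + 1)" by (simp add: algebra_simps)
    finally show ?case
      using exec.WhileTrue[OF b(1) 1(1) 2(1)] 2(2) Suc.hyps(2) unfolding runs_def by auto
  qed
  from this[of 0 s] show ?thesis using init by simp
qed

lemma regs_set_reg [simp]: "regs (set_reg r a s) = (regs s)(r := a)"
  and mem_set_reg [simp]: "mem (set_reg r a s) = mem s"
  and regs_set_mem [simp]: "regs (set_mem p a s) = regs s"
  and mem_set_mem [simp]: "mem (set_mem p a s) = (mem s)(p := a)"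
  by (simp_all add: set_reg_def set_mem_def)

section \<open>Table lookup and double loops\<close>

fun block :: "com list \<Rightarrow> com" where
  "block [] = Skip"
| "block [c] = c"
| "block (c # cs) = Seq c (block cs)"

text \<open>The table is a chain of comparisons in the program text, since the initial memory offers
  nothing but the input.\<close>

fun lookup :: "nat \<Rightarrow> nat \<Rightarrow> (nat \<Rightarrow> nat) \<Rightarrow> nat \<Rightarrow> com" where
  "lookup r x T 0 = Skip"
| "lookup r x T (Suc m) = Seq (lookup r x T m) (If (Eq (Reg x) (Imm m)) (Move r (Imm (T m))) Skip)"

lemma wp_lookup:
  assumes "x \<noteq> r" "m \<le> 2 ^ L" "regs s x < 2 ^ L" "\<And>i. T i < 2 ^ L"
  shows "wp L (lookup r x T m) Q s \<longleftrightarrow> Q (if regs s x < m then set_reg r (T (regs s x)) s else s)"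
  using assms(2)
proof (induction m arbitrary: Q)
  case (Suc m)
  then show ?case using assms(1,3,4) by (auto simp: less_Suc_eq)
qed simp

definition sweep :: "com \<Rightarrow> com" where
  "sweep c = While (Less (Reg 5) (Reg 0)) (block [Move 6 (Imm 0),
     While (Less (Reg 6) (Reg 3)) (Seq c (Arith 6 Add (Reg 6) (Imm 1))),
     Arith 5 Add (Reg 5) (Imm 1)])"

text \<open>The invariant is indexed by the set of treated pairs and not by the counters, because
  the effects of marking and of probing depend only on that set. One lemma then serves both sweeps,
  provided that the body keeps the counters and \<open>J\<close> is insensitive to changing
  them.\<close>

lemma runs_sweep:
  assumes body: "\<And>S s i e. i < n \<Longrightarrow> e < E \<Longrightarrow> J S s \<Longrightarrow> regs s 5 = i \<Longrightarrow> regs s 6 = e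
      \<Longrightarrow> runs L c s (\<lambda>s'. J (insert (i, e) S) s' \<and> regs s' 5 = i \<and> regs s' 6 = e) k"
    and frame: "\<And>S s a. J S s \<Longrightarrow> J S (set_reg 5 a s)" "\<And>S s a. J S s \<Longrightarrow> J S (set_reg 6 a s)"
    and J: "\<And>S s. J S s \<Longrightarrow> regs s 0 = n \<and> regs s 3 = E"
    and bounds: "n < 2 ^ L" "E < 2 ^ L" "1 \<le> L"
    and init: "J {} s" "regs s 5 = 0"
  shows "runs L (sweep c) s (J ({..<n} \<times> {..<E})) (n * (E * (k + 2) + 4) + 1)"
proof -
  have one: "1 < (2::nat) ^ L" using bounds(3) by (intro one_less_power) auto
  have inner: "runs L (While (Less (Reg 6) (Reg 3)) (Seq c (Arith 6 Add (Reg 6) (Imm 1)))) s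
      (\<lambda>s. J ({..<Suc i} \<times> {..<E}) s \<and> regs s 5 = i) (E * (k + 1 + 1) + 1)"
    if i: "i < n" and s: "J ({..<i} \<times> {..<E}) s" "regs s 5 = i" "regs s 6 = 0" for i s
  proof -
    define I where "I = (\<lambda>e s. J ({..<i} \<times> {..<E} \<union> {i} \<times> {..<e}) s \<and> regs s 5 = i \<and> regs s 6 = e)"
    have "runs L (While (Less (Reg 6) (Reg 3)) (Seq c (Arith 6 Add (Reg 6) (Imm 1)))) s (I E) (E * (k + 1 + 1) + 1)"
    proof (rule runs_While)
      fix e s assume e: "e < E" and "I e s"
      then have Is: "J ({..<i} \<times> {..<E} \<union> {i} \<times> {..<e}) s" "regs s 5 = i" "regs s 6 = e"
        by (auto simp: I_def)
      have set_eq: "insert (i, e) ({..<i} \<times> {..<E} \<union> {i} \<times> {..<e}) = {..<i} \<times> {..<E} \<union> {i} \<times> {..<Suc e}"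
        by auto
      have "runs L (Seq c (Arith 6 Add (Reg 6) (Imm 1))) s (I (Suc e)) (k + 1)"
      proof (rule runs_Seq[OF body[OF i e Is]])
        fix s' assume s': "J (insert (i, e) ({..<i} \<times> {..<E} \<union> {i} \<times> {..<e})) s' \<and> regs s' 5 = i \<and> regs s' 6 = e"
        have "wp L (Arith 6 Add (Reg 6) (Imm 1)) (I (Suc e)) s'"
          using s' frame(2)[of "{..<i} \<times> {..<E} \<union> {i} \<times> {..<Suc e}" s' "Suc e"] e bounds one
          unfolding set_eq by (simp add: I_def)
        from wp_runs[OF this] show "runs L (Arith 6 Add (Reg 6) (Imm 1)) s' (I (Suc e)) 1" by simp
      qed
      then show "test_val (Less (Reg 6) (Reg 3)) s \<and> test_fits L (Less (Reg 6) (Reg 3)) s \<and>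
          runs L (Seq c (Arith 6 Add (Reg 6) (Imm 1))) s (I (Suc e)) (k + 1)"
        using Is J[OF Is(1)] e bounds by simp
    next
      fix s assume "I E s"
      then show "\<not> test_val (Less (Reg 6) (Reg 3)) s \<and> test_fits L (Less (Reg 6) (Reg 3)) s"
        using J bounds by (auto simp: I_def)
    qed (use s in \<open>simp add: I_def\<close>)
    moreover have "{..<i} \<times> {..<E} \<union> {i} \<times> {..<E} = {..<Suc i} \<times> {..<E}" by auto
    ultimately show ?thesis by (auto simp: I_def intro: runs_mono)
  qed
  define I where "I = (\<lambda>i s. J ({..<i} \<times> {..<E}) s \<and> regs s 5 = i)"
  have "runs L (sweep c) s (I n) (n * (1 + ((E * (k + 1 + 1) + 1) + 1) + 1) + 1)"
    unfolding sweep_def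
  proof (rule runs_While)
    fix i s assume i: "i < n" and "I i s"
    then have Is: "J ({..<i} \<times> {..<E}) s" "regs s 5 = i" by (auto simp: I_def)
    have "runs L (block [Move 6 (Imm 0),
       While (Less (Reg 6) (Reg 3)) (Seq c (Arith 6 Add (Reg 6) (Imm 1))),
       Arith 5 Add (Reg 5) (Imm 1)]) s (I (Suc i)) (1 + ((E * (k + 1 + 1) + 1) + 1))"
      unfolding block.simps
    proof (rule runs_Seq)
      have "wp L (Move 6 (Imm 0)) (\<lambda>s. J ({..<i} \<times> {..<E}) s \<and> regs s 5 = i \<and> regs s 6 = 0) s"
        using Is frame by simp
      from wp_runs[OF this]
      show "runs L (Move 6 (Imm 0)) s (\<lambda>s. J ({..<i} \<times> {..<E}) s \<and> regs s 5 = i \<and> regs s 6 = 0) 1"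
        by simp
    next
      fix s assume s: "J ({..<i} \<times> {..<E}) s \<and> regs s 5 = i \<and> regs s 6 = 0"
      show "runs L (Seq (While (Less (Reg 6) (Reg 3)) (Seq c (Arith 6 Add (Reg 6) (Imm 1))))
          (Arith 5 Add (Reg 5) (Imm 1))) s (I (Suc i)) ((E * (k + 1 + 1) + 1) + 1)"
      proof (rule runs_Seq[OF inner[OF i]])
        fix s' assume s': "J ({..<Suc i} \<times> {..<E}) s' \<and> regs s' 5 = i"
        have "wp L (Arith 5 Add (Reg 5) (Imm 1)) (I (Suc i)) s'"
          using s' frame(1)[of "{..<Suc i} \<times> {..<E}" s' "Suc i"] i bounds one by (simp add: I_def)
        from wp_runs[OF this] show "runs L (Arith 5 Add (Reg 5) (Imm 1)) s' (I (Suc i)) 1" by simp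
      qed (use s in auto)
    qed
    then show "test_val (Less (Reg 5) (Reg 0)) s \<and> test_fits L (Less (Reg 5) (Reg 0)) s \<and>
        runs L (block [Move 6 (Imm 0),
         While (Less (Reg 6) (Reg 3)) (Seq c (Arith 6 Add (Reg 6) (Imm 1))),
         Arith 5 Add (Reg 5) (Imm 1)]) s (I (Suc i)) (1 + ((E * (k + 1 + 1) + 1) + 1))"
      using Is J[OF Is(1)] i bounds by simp
  next
    fix s assume "I n s"
    then show "\<not> test_val (Less (Reg 5) (Reg 0)) s \<and> test_fits L (Less (Reg 5) (Reg 0)) s"
      using J bounds by (auto simp: I_def)
  qed (use init in \<open>simp add: I_def\<close>)
  then show ?thesis by (rule runs_mono) (auto simp: I_def algebra_simps)
qed

section \<open>The program\<close>

text \<open>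
  Registers: 0 and 1 hold \<open>n\<close> and \<open>d\<close>, 2 the number \<open>k\<close> of blocks, 3 the number \<open>\<Delta> ^ k\<close> of keys
  per vector, 4 the base address of the table of marks, 5 the index of the current vector, 6 the
  number of the current key, 16 the answer, 17 the address of the first vector of the current
  half; 7 to 15 are scratch, with the key returned in 12.
\<close>

definition bit_com :: com where
  "bit_com = block [Move 14 (Imm 0),
     If (Less (Reg 9) (Reg 1)) (Load 14 (Reg 10)) Skip,
     Arith 11 Mul (Imm 2) (Reg 11), Arith 11 Add (Reg 11) (Reg 14),
     Arith 9 Add (Reg 9) (Imm 1), Arith 10 Add (Reg 10) (Imm 1), Arith 13 Add (Reg 13) (Imm 1)]"

text \<open>There is no remainder operation, so the next digit of \<open>e\<close> is obtained from
  a division, a product and a difference. The block code and this digit are merged into one index of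
  the flattened table.\<close>

definition digit_com :: "(nat \<Rightarrow> nat \<Rightarrow> nat) \<Rightarrow> nat \<Rightarrow> nat \<Rightarrow> nat \<Rightarrow> com" where
  "digit_com T B \<Delta> R = block [Arith 14 Div (Reg 7) (Imm \<Delta>), Arith 15 Mul (Reg 14) (Imm \<Delta>),
     Arith 15 Sub (Reg 7) (Reg 15), Move 7 (Reg 14),
     Arith 11 Mul (Reg 11) (Imm \<Delta>), Arith 11 Add (Reg 11) (Reg 15),
     lookup 15 11 (\<lambda>i. T (i div \<Delta>) (i mod \<Delta>)) (2 ^ B * \<Delta>),
     Arith 12 Mul (Imm R) (Reg 12), Arith 12 Add (Reg 12) (Reg 15), Arith 8 Add (Reg 8) (Imm 1)]"

definition key_com :: "(nat \<Rightarrow> nat \<Rightarrow> nat) \<Rightarrow> nat \<Rightarrow> nat \<Rightarrow> nat \<Rightarrow> com" where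
  "key_com T B \<Delta> R = Seq
     (block [Move 7 (Reg 6), Move 8 (Imm 0), Move 9 (Imm 0), Move 12 (Imm 0),
        Arith 10 Mul (Reg 5) (Reg 1), Arith 10 Add (Reg 10) (Reg 17)])
     (While (Less (Reg 8) (Reg 2))
       (Seq (block [Move 11 (Imm 0), Move 13 (Imm 0)])
         (Seq (While (Less (Reg 13) (Imm B)) bit_com) (digit_com T B \<Delta> R))))"

definition frame :: "state \<Rightarrow> state \<Rightarrow> bool" where
  "frame s0 s \<longleftrightarrow> mem s = mem s0 \<and> (\<forall>r. r < 7 \<or> 15 < r \<longrightarrow> regs s r = regs s0 r)"

definition coord :: "(nat \<Rightarrow> nat) \<Rightarrow> nat \<Rightarrow> nat \<Rightarrow> nat \<Rightarrow> nat" where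
  "coord M st d j = (if j < d then M (st + j) else 0)"

text \<open>The offset \<open>off\<close> lets the same code serve both halves of the input. The
  assumptions \<open>L\<close> keep all intermediate values below \<open>2 ^ L\<close>; an
  unfinished key stays within the bound \<open>R ^ k\<close> for a complete one.\<close>

lemma runs_key_com:
  fixes st e d k
  assumes regs: "regs s0 1 = d" "regs s0 2 = k" "regs s0 6 = e" "regs s0 5 = i" "regs s0 17 = off"
    and st: "st = i * d + off"
    and bits: "\<And>j. j < d \<Longrightarrow> mem s0 (st + j) < 2"
    and T: "\<And>w g. T w g < R" and pos: "0 < \<Delta>"
    and L: "i < 2 ^ L" "d < 2 ^ L" "e < 2 ^ L" "st + k * B + B < 2 ^ L" "k < 2 ^ L"
      "2 ^ B * \<Delta> < 2 ^ L" "R < 2 ^ L" "R ^ k < 2 ^ L" "2 \<le> L"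
  shows "runs L (key_com T B \<Delta> R) s0
     (\<lambda>s. frame s0 s \<and> regs s 12 = key T B \<Delta> R (coord (mem s0) st d) e k)
     (6 + (k * (2 + (B * (steps bit_com + 1) + 1 + steps (digit_com T B \<Delta> R)) + 1) + 1))"
proof -
  define \<beta> where "\<beta> = coord (mem s0) st d"
  have \<beta>2: "\<beta> j < 2" for j using bits by (simp add: \<beta>_def coord_def)
  \<comment> \<open>\<open>I m\<close> describes the state after \<open>m\<close> blocks,
    \<open>I2 m j\<close> the state after \<open>j\<close> further bits of block
    \<open>m\<close>.\<close>
  define I where "I = (\<lambda>m s. frame s0 s \<and> regs s 7 = e div \<Delta> ^ m \<and> regs s 8 = m \<and>
     regs s 9 = m * B \<and> regs s 10 = st + m * B \<and> regs s 12 = key T B \<Delta> R \<beta> e m)"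
  define I2 where "I2 = (\<lambda>m j s. frame s0 s \<and> regs s 7 = e div \<Delta> ^ m \<and> regs s 8 = m \<and>
     regs s 9 = m * B + j \<and> regs s 10 = st + m * B + j \<and> regs s 12 = key T B \<Delta> R \<beta> e m \<and>
     regs s 11 = horner 2 (\<lambda>j. \<beta> (m * B + j)) j \<and> regs s 13 = j)"
  have two: "2 < (2::nat) ^ L" using power_strict_increasing[of 1 L "2::nat"] L by simp
  have fr: "regs s 0 = regs s0 0" "regs s 1 = d" "regs s 2 = k" "regs s 5 = i" "regs s 6 = e" "regs s 17 = off"
      "mem s = mem s0" if "frame s0 s" for s
    using that regs by (auto simp: frame_def)
  have B\<Delta>: "2 ^ B \<le> 2 ^ B * \<Delta>" using pos by simp
  have \<Delta>L: "\<Delta> < 2 ^ L" using L(6) by (metis le_less_trans mult_le_mono1 nat_mult_1 one_le_numeral one_le_power)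
  have inner: "runs L (While (Less (Reg 13) (Imm B)) bit_com) s (I2 m B) (B * (steps bit_com + 1) + 1)"
    if m: "m < k" and s: "I2 m 0 s" for m s
  proof (rule runs_While)
    fix j s assume j: "j < B" and I2: "I2 m j s"
    have "Suc m * B \<le> k * B" using m by (intro mult_right_mono) auto
    then have mB: "m * B + B \<le> k * B" by simp
    then have bnd: "st + m * B + j < 2 ^ L" "m * B + j < 2 ^ L" "j < 2 ^ L" "B < 2 ^ L"
      using L(4) j by linarith+
    have h: "horner 2 (\<lambda>j. \<beta> (m * B + j)) (Suc j) < 2 ^ Suc j"
      by (rule horner_less) (rule \<beta>2)
    have "2 * horner 2 (\<lambda>j. \<beta> (m * B + j)) j + \<beta> (m * B + j) < 2 ^ Suc j" using h by simp
    also have "2 ^ Suc j \<le> (2::nat) ^ B" using j by (intro power_increasing) auto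
    also note B\<Delta>
    also note L(6)
    finally have h2: "2 * horner 2 (\<lambda>j. \<beta> (m * B + j)) j + \<beta> (m * B + j) < 2 ^ L" .
    have \<beta>L: "\<beta> (m * B + j) < 2 ^ L" using \<beta>2[of "m * B + j"] two by linarith
    have "wp L bit_com (I2 m (Suc j)) s"
    proof -
      have f: "frame s0 s" using I2 by (simp add: I2_def)
      have b: "\<beta> (m * B + j) = (if m * B + j < d then mem s0 (st + m * B + j) else 0)"
        by (simp add: \<beta>_def coord_def add.assoc)
      show ?thesis
        using I2 f fr[OF f] bnd two h2 \<beta>L L(2) unfolding b
        by (auto simp: bit_com_def I2_def b frame_def)
    qed
    from wp_runs[OF this]
    show "test_val (Less (Reg 13) (Imm B)) s \<and> test_fits L (Less (Reg 13) (Imm B)) s \<and>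
        runs L bit_com s (I2 m (Suc j)) (steps bit_com)"
      using I2 j bnd by (simp add: I2_def)
  next
    fix s assume "I2 m B s"
    moreover have "B < 2 ^ L" using L(4) by linarith
    ultimately show "\<not> test_val (Less (Reg 13) (Imm B)) s \<and> test_fits L (Less (Reg 13) (Imm B)) s"
      by (simp add: I2_def)
  qed (rule s)
  have digit: "wp L (digit_com T B \<Delta> R) (I (Suc m)) s" if m: "m < k" and I2: "I2 m B s" for m s
  proof -
    define w where "w = block_code B \<beta> m"
    define q where "q = e div \<Delta> ^ m"
    define g where "g = q mod \<Delta>"
    define h where "h = key T B \<Delta> R \<beta> e m"
    have w: "w < 2 ^ B" unfolding w_def block_code_def by (rule horner_less) (rule \<beta>2)
    have g: "g < \<Delta>" using pos by (simp add: g_def)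
    have q: "q < 2 ^ L" using L(3) div_le_dividend[of e "\<Delta> ^ m"] unfolding q_def by linarith
    have hR: "R * h + T w g < R ^ Suc m"
      using horner_less[of "Suc m" "\<lambda>m. T (block_code B \<beta> m) (e div \<Delta> ^ m mod \<Delta>)" R] T
      unfolding h_def key_def w_def g_def q_def by simp
    moreover have "R ^ Suc m \<le> R ^ k" using m T[of 0 0] by (intro power_increasing) auto
    ultimately have hL: "R * h + T w g < 2 ^ L" using L(8) by linarith
    have "h \<le> R * h" using T[of 0 0] by simp
    then have hL': "h < 2 ^ L" using hL by linarith
    have TL: "T w g < 2 ^ L" for w g using T[of w g] L(7) by linarith
    have "(w + 1) * \<Delta> \<le> 2 ^ B * \<Delta>" using w by (intro mult_right_mono) auto
    then have idx: "w * \<Delta> + g < 2 ^ B * \<Delta>" using g by simp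
    have "q div \<Delta> \<le> q" "q div \<Delta> * \<Delta> \<le> q" by simp_all
    then have q2: "q div \<Delta> < 2 ^ L" "q div \<Delta> * \<Delta> < 2 ^ L" "w < 2 ^ L" "w * \<Delta> < 2 ^ L" "g < 2 ^ L"
      using q idx L(6) w B\<Delta> g \<Delta>L by linarith+
    have sub: "q - q div \<Delta> * \<Delta> = g" by (simp add: g_def minus_div_mult_eq_mod)
    have T_idx: "T ((w * \<Delta> + g) div \<Delta>) ((w * \<Delta> + g) mod \<Delta>) = T w g" using g pos by simp
    have key_Suc: "key T B \<Delta> R \<beta> e (Suc m) = R * h + T w g"
      by (simp add: key_def h_def w_def g_def q_def)
    have q_Suc: "e div \<Delta> ^ Suc m = q div \<Delta>"
      by (simp only: q_def power_Suc2 div_mult2_eq)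
    have I2': "frame s0 s" "regs s 7 = q" "regs s 8 = m" "regs s 9 = Suc m * B"
      "regs s 10 = st + Suc m * B" "regs s 12 = h" "regs s 11 = w"
      using I2 by (simp_all add: I2_def q_def h_def w_def block_code_def)
    show ?thesis
      using I2' q q2 hL hL' TL idx L(5,6,7) two m \<Delta>L sub T_idx
      by (simp add: digit_com_def I_def key_Suc q_Suc q_Suc[unfolded power_Suc] wp_lookup frame_def
          less_imp_le)
  qed
  have init: "wp L (block [Move 7 (Reg 6), Move 8 (Imm 0), Move 9 (Imm 0), Move 12 (Imm 0),
        Arith 10 Mul (Reg 5) (Reg 1), Arith 10 Add (Reg 10) (Reg 17)]) (I 0) s0"
    using regs L st by (simp add: I_def frame_def key_def)
  have "runs L (key_com T B \<Delta> R) s0 (I k)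
     (6 + (k * (2 + (B * (steps bit_com + 1) + 1 + steps (digit_com T B \<Delta> R)) + 1) + 1))"
    unfolding key_com_def
  proof (rule runs_Seq)
    show "runs L (block [Move 7 (Reg 6), Move 8 (Imm 0), Move 9 (Imm 0), Move 12 (Imm 0),
        Arith 10 Mul (Reg 5) (Reg 1), Arith 10 Add (Reg 10) (Reg 17)]) s0 (I 0) 6"
      using wp_runs[OF init] by (simp add: numeral_eq_Suc)
  next
    fix s assume "I 0 s"
    then show "runs L (While (Less (Reg 8) (Reg 2))
       (Seq (block [Move 11 (Imm 0), Move 13 (Imm 0)])
         (Seq (While (Less (Reg 13) (Imm B)) bit_com) (digit_com T B \<Delta> R)))) s (I k)
       (k * (2 + (B * (steps bit_com + 1) + 1 + steps (digit_com T B \<Delta> R)) + 1) + 1)"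
    proof (rule runs_While[rotated 2])
      fix m s assume m: "m < k" and I: "I m s"
      then have f: "frame s0 s" by (simp add: I_def)
      have "wp L (block [Move 11 (Imm 0), Move 13 (Imm 0)]) (I2 m 0) s"
        using I by (simp add: I_def I2_def frame_def)
      from wp_runs[OF this] have "runs L (block [Move 11 (Imm 0), Move 13 (Imm 0)]) s (I2 m 0) 2"
        by (simp add: numeral_eq_Suc)
      then have "runs L (Seq (block [Move 11 (Imm 0), Move 13 (Imm 0)])
         (Seq (While (Less (Reg 13) (Imm B)) bit_com) (digit_com T B \<Delta> R))) s (I (Suc m))
         (2 + (B * (steps bit_com + 1) + 1 + steps (digit_com T B \<Delta> R)))"
        by (rule runs_Seq) (rule runs_Seq[OF inner[OF m]], assumption, rule wp_runs[OF digit[OF m]])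
      then show "test_val (Less (Reg 8) (Reg 2)) s \<and> test_fits L (Less (Reg 8) (Reg 2)) s \<and>
        runs L (Seq (block [Move 11 (Imm 0), Move 13 (Imm 0)])
         (Seq (While (Less (Reg 13) (Imm B)) bit_com) (digit_com T B \<Delta> R))) s (I (Suc m))
         (2 + (B * (steps bit_com + 1) + 1 + steps (digit_com T B \<Delta> R)))"
        using I m fr[OF f] L(5) by (simp add: I_def)
    next
      fix s assume I: "I k s"
      then have f: "frame s0 s" by (simp add: I_def)
      show "\<not> test_val (Less (Reg 8) (Reg 2)) s \<and> test_fits L (Less (Reg 8) (Reg 2)) s"
        using I fr[OF f] L(5) by (simp add: I_def)
    qed
  qed
  then show ?thesis by (rule runs_mono) (auto simp: I_def \<beta>_def)
qed

section \<open>Marking and probing\<close>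

definition mark_com :: "(nat \<Rightarrow> nat \<Rightarrow> nat) \<Rightarrow> nat \<Rightarrow> nat \<Rightarrow> nat \<Rightarrow> com" where
  "mark_com T B \<Delta> R = Seq (key_com T B \<Delta> R)
     (block [Arith 12 Add (Reg 12) (Reg 4), Store (Reg 12) (Imm 1)])"

definition probe_com :: "(nat \<Rightarrow> nat \<Rightarrow> nat) \<Rightarrow> nat \<Rightarrow> nat \<Rightarrow> nat \<Rightarrow> com" where
  "probe_com T B \<Delta> R = Seq (key_com T B \<Delta> R)
     (block [Arith 12 Add (Reg 12) (Reg 4), Load 14 (Reg 12),
        If (Eq (Reg 14) (Imm 1)) (Move 16 (Imm 1)) Skip])"

text \<open>The first two operations round \<open>d / B\<close> up. The marks begin right behind the
  input, where all cells are zero from the start, so the table is never cleared. The initial zeros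
  of registers 5, 8, 16 and 17 are relied on too; only register 5 has to be reset, before the second
  sweep.\<close>

definition ov_com :: "(nat \<Rightarrow> nat \<Rightarrow> nat) \<Rightarrow> (nat \<Rightarrow> nat \<Rightarrow> nat) \<Rightarrow> nat \<Rightarrow> nat \<Rightarrow> nat \<Rightarrow> com" where
  "ov_com T T' B \<Delta> R = Seq
     (block [Arith 2 Add (Reg 1) (Imm (B - 1)), Arith 2 Div (Reg 2) (Imm B), Move 3 (Imm 1),
        Arith 4 Mul (Reg 0) (Reg 1), Arith 4 Mul (Imm 2) (Reg 4)])
     (Seq (While (Less (Reg 8) (Reg 2))
         (block [Arith 3 Mul (Reg 3) (Imm \<Delta>), Arith 8 Add (Reg 8) (Imm 1)]))
       (Seq (sweep (mark_com T B \<Delta> R))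
         (Seq (block [Arith 17 Mul (Reg 0) (Reg 1), Move 5 (Imm 0)])
           (Seq (sweep (probe_com T' B \<Delta> R)) (Move 0 (Reg 16))))))"

definition body_steps :: "(nat \<Rightarrow> nat \<Rightarrow> nat) \<Rightarrow> nat \<Rightarrow> nat \<Rightarrow> nat \<Rightarrow> nat \<Rightarrow> nat" where
  "body_steps T B \<Delta> R k
     = 11 + (k * (2 + (B * (steps bit_com + 1) + 1 + steps (digit_com T B \<Delta> R)) + 1) + 1)"

locale ov_run =
  fixes T T' :: "nat \<Rightarrow> nat \<Rightarrow> nat" and B \<Delta> R n d L :: nat and u v :: "nat \<Rightarrow> int vec"
  assumes T: "\<And>w g. T w g < R" and T': "\<And>w g. T' w g < R"
    and B1: "1 \<le> B" and \<Delta>1: "1 \<le> \<Delta>"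
    and tables: "\<And>\<beta> \<gamma>. (\<And>j. j < B \<Longrightarrow> \<beta> j < 2) \<Longrightarrow> (\<And>j. j < B \<Longrightarrow> \<gamma> j < 2) \<Longrightarrow>
       (\<exists>g<\<Delta>. \<exists>g'<\<Delta>. T (horner 2 \<beta> B) g = T' (horner 2 \<gamma> B) g')
         \<longleftrightarrow> (\<forall>j<B. \<beta> j = 0 \<or> \<gamma> j = 0)"
    and inst: "ov_instance n d u v"
  fixes k defines "k \<equiv> (d + (B - 1)) div B"
  assumes L: "n < 2 ^ L" "d + B < 2 ^ L" "\<Delta> ^ k < 2 ^ L" "2 * (n * d) + k * B + B < 2 ^ L"
      "2 ^ B * \<Delta> < 2 ^ L" "2 * (n * d) + R ^ k < 2 ^ L" "R < 2 ^ L" "2 \<le> L"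
begin

definition "E = \<Delta> ^ k"
definition "base = 2 * (n * d)"
definition "M0 = mem (ov_input n d u v)"
definition "ku i e = key T B \<Delta> R (coord M0 (i * d) d) e k"
definition "kv i e = key T' B \<Delta> R (coord M0 (i * d + n * d) d) e k"
definition "marks S a = (if \<exists>i e. (i, e) \<in> S \<and> a = base + ku i e then 1 else M0 a)"

lemma k_less: "k < 2 ^ L"
proof -
  have "k \<le> d + (B - 1)" unfolding k_def by (rule div_le_dividend)
  then show ?thesis using L(2) by linarith
qed

lemma kB: "d \<le> k * B"
proof -
  have "d + (B - 1) = k * B + (d + (B - 1)) mod B" unfolding k_def by simp
  moreover have "(d + (B - 1)) mod B < B" using B1 by simp
  ultimately show ?thesis using B1 by linarith
qed

lemma index_less:
  assumes "i < n" "j < d"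
  shows "i * d + j < n * d"
proof -
  have "i * d + j < Suc i * d" using assms by simp
  also have "\<dots> \<le> n * d" using assms by (intro mult_right_mono) auto
  finally show ?thesis .
qed

lemma M0_u: "i < n \<Longrightarrow> j < d \<Longrightarrow> M0 (i * d + j) = nat (u i $ j)"
  using index_less[of i j] by (simp add: M0_def ov_input_def)

lemma M0_v:
  assumes "i < n" "j < d"
  shows "M0 (i * d + n * d + j) = nat (v i $ j)"
proof -
  have "i * d + n * d + j = n * d + (i * d + j)" by simp
  moreover have "n * d + (i * d + j) < 2 * n * d" "\<not> n * d + (i * d + j) < n * d"
    using index_less[OF assms] unfolding mult.assoc by linarith+
  ultimately show ?thesis
    using assms(2) by (simp only: M0_def ov_input_def state.simps if_True if_False diff_add_inverse) simp
qed

lemma M0_base: "base \<le> a \<Longrightarrow> M0 a = 0"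
  by (simp add: M0_def base_def ov_input_def)

lemma uv_bits:
  assumes "i < n" "j < d"
  shows "u i $ j = 0 \<or> u i $ j = 1" "v i $ j = 0 \<or> v i $ j = 1"
  using inst assms unfolding ov_instance_def by blast+

lemma coord_less: "i < n \<Longrightarrow> coord M0 (i * d) d j < 2" "i < n \<Longrightarrow> coord M0 (i * d + n * d) d j < 2"
  using uv_bits[of i j] M0_u[of i j] M0_v[of i j] by (auto simp: coord_def)

lemma key_less: "ku i e < R ^ k" "kv i e < R ^ k"
  unfolding ku_def kv_def key_def by (rule horner_less, rule T T')+

text \<open>A sum of nonnegative products vanishes iff each product does, and the padding beyond
  \<open>d\<close> only adds positions where \<open>coord\<close> is 0.\<close>

lemma scalar_prod_zero_iff:
  assumes "i < n" "i' < n"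
  shows "u i \<bullet> v i' = 0
    \<longleftrightarrow> (\<forall>j<k * B. coord M0 (i * d) d j = 0 \<or> coord M0 (i' * d + n * d) d j = 0)"
proof -
  have dim: "dim_vec (v i') = d" using inst assms by (auto simp: ov_instance_def)
  have bits: "u i $ j \<in> {0, 1}" "v i' $ j \<in> {0, 1}" if "j < d" for j
    using uv_bits[OF assms(1) that] uv_bits[OF assms(2) that] by auto
  have "u i \<bullet> v i' = (\<Sum>j<d. u i $ j * v i' $ j)"
    by (simp add: scalar_prod_def dim atLeast0LessThan)
  also have "\<dots> = 0 \<longleftrightarrow> (\<forall>j\<in>{..<d}. u i $ j * v i' $ j = 0)"
    using bits by (intro sum_nonneg_eq_0_iff) fastforce+
  also have "\<dots> \<longleftrightarrow> (\<forall>j<d. coord M0 (i * d) d j = 0 \<or> coord M0 (i' * d + n * d) d j = 0)"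
    using bits assms by (force simp: coord_def M0_u M0_v)
  also have "\<dots> \<longleftrightarrow> (\<forall>j<k * B. coord M0 (i * d) d j = 0 \<or> coord M0 (i' * d + n * d) d j = 0)"
    using kB by (auto simp: coord_def)
  finally show ?thesis .
qed

text \<open>From \<open>base\<close> on the initial memory is zero, so a cell there contains 1
  exactly if some \<open>u i\<close> has marked it; \<open>key_match_iff\<close> translates the
  shared key into orthogonality.\<close>

lemma has_orthogonal_pair_iff:
  "has_orthogonal_pair n u v
    \<longleftrightarrow> (\<exists>i' e'. (i', e') \<in> {..<n} \<times> {..<E} \<and> marks ({..<n} \<times> {..<E}) (base + kv i' e') = 1)"
proof -
  have "u i \<bullet> v i' = 0 \<longleftrightarrow> (\<exists>e<E. \<exists>e'<E. ku i e = kv i' e')" if "i < n" "i' < n" for i i'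
    unfolding scalar_prod_zero_iff[OF that] E_def ku_def kv_def
    by (rule key_match_iff[symmetric])
       (rule B1 \<Delta>1 T T' tables coord_less that | assumption)+
  then show ?thesis
    unfolding has_orthogonal_pair_def marks_def
    by (auto simp: M0_base)  metis+
qed

lemma runs_mark:
  assumes i: "i < n" and e: "e < E"
    and s: "mem s = marks S" "regs s 0 = n" "regs s 1 = d" "regs s 2 = k" "regs s 3 = E"
      "regs s 4 = base" "regs s 16 = 0" "regs s 17 = 0" "regs s 5 = i" "regs s 6 = e"
  shows "runs L (mark_com T B \<Delta> R) s (\<lambda>s'. mem s' = marks (insert (i, e) S) \<and>
      (\<forall>r. r < 7 \<or> 15 < r \<longrightarrow> regs s' r = regs s r)) (body_steps T B \<Delta> R k)"
proof -
  \<comment> \<open>All marks lie at \<open>base\<close> or behind it, so the entries of the vectors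
    are still intact.\<close>
  have coord_eq: "coord (mem s) (i * d) d = coord M0 (i * d) d"
  proof
    fix j show "coord (mem s) (i * d) d j = coord M0 (i * d) d j"
      using index_less[OF i, of j] s(1) by (auto simp: coord_def marks_def base_def)
  qed
  have bits: "mem s (i * d + j) < 2" if "j < d" for j
    using coord_less(1)[OF i, of j] that unfolding coord_eq[symmetric] by (simp add: coord_def)
  have st: "i * d + k * B + B < 2 ^ L"
  proof -
    have "i * d \<le> n * d" using i by (intro mult_right_mono) auto
    then show ?thesis using L(4) by linarith
  qed
  have kc: "runs L (key_com T B \<Delta> R) s (\<lambda>s'. frame s s' \<and> regs s' 12 = ku i e)
     (6 + (k * (2 + (B * (steps bit_com + 1) + 1 + steps (digit_com T B \<Delta> R)) + 1) + 1))"
    unfolding ku_def coord_eq[symmetric]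
    by (rule runs_key_com[where i = i and off = 0])
       (use s bits T \<Delta>1 st i e L k_less in \<open>auto simp: E_def\<close>)
  have "runs L (mark_com T B \<Delta> R) s (\<lambda>s'. mem s' = marks (insert (i, e) S) \<and>
      (\<forall>r. r < 7 \<or> 15 < r \<longrightarrow> regs s' r = regs s r))
     (6 + (k * (2 + (B * (steps bit_com + 1) + 1 + steps (digit_com T B \<Delta> R)) + 1) + 1) + 2)"
    unfolding mark_com_def
  proof (rule runs_Seq[OF kc])
    fix s' assume s': "frame s s' \<and> regs s' 12 = ku i e"
    have b: "base + ku i e < 2 ^ L" using key_less(1)[of i e] L(6) by (simp add: base_def)
    have mm: "(marks S)(base + ku i e := 1) = marks (insert (i, e) S)"
      by (rule ext) (auto simp: marks_def)
    have "wp L (block [Arith 12 Add (Reg 12) (Reg 4), Store (Reg 12) (Imm 1)])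
       (\<lambda>s'. mem s' = marks (insert (i, e) S) \<and> (\<forall>r. r < 7 \<or> 15 < r \<longrightarrow> regs s' r = regs s r)) s'"
      using s' s b mm L(8) one_less_power[of "2::nat" L]
      by (auto simp: frame_def add.commute[of _ base])
    from wp_runs[OF this]
    show "runs L (block [Arith 12 Add (Reg 12) (Reg 4), Store (Reg 12) (Imm 1)]) s'
       (\<lambda>s'. mem s' = marks (insert (i, e) S) \<and> (\<forall>r. r < 7 \<or> 15 < r \<longrightarrow> regs s' r = regs s r)) 2"
      by (simp add: numeral_eq_Suc)
  qed
  then show ?thesis by (rule runs_mono) (auto simp: body_steps_def)
qed

abbreviation "M1 \<equiv> marks ({..<n} \<times> {..<E})"

lemma runs_probe:
  assumes i: "i < n" and e: "e < E"
    and s: "mem s = M1" "regs s 0 = n" "regs s 1 = d" "regs s 2 = k" "regs s 3 = E"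
      "regs s 4 = base" "regs s 17 = n * d" "regs s 5 = i" "regs s 6 = e"
  shows "runs L (probe_com T' B \<Delta> R) s (\<lambda>s'. mem s' = M1 \<and>
      regs s' 16 = (if M1 (base + kv i e) = 1 then 1 else regs s 16) \<and>
      (\<forall>r. r < 7 \<or> r = 17 \<longrightarrow> regs s' r = regs s r)) (body_steps T' B \<Delta> R k)"
proof -
  have coord_eq: "coord (mem s) (i * d + n * d) d = coord M0 (i * d + n * d) d"
  proof
    fix j show "coord (mem s) (i * d + n * d) d j = coord M0 (i * d + n * d) d j"
      using index_less[OF i, of j] s(1) by (auto simp: coord_def marks_def base_def)
  qed
  have bits: "mem s (i * d + n * d + j) < 2" if "j < d" for j
    using coord_less(2)[OF i, of j] that unfolding coord_eq[symmetric] by (simp add: coord_def)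
  have st: "i * d + n * d + k * B + B < 2 ^ L"
  proof -
    have "i * d \<le> n * d" using i by (intro mult_right_mono) auto
    then show ?thesis using L(4) by linarith
  qed
  have kc: "runs L (key_com T' B \<Delta> R) s (\<lambda>s'. frame s s' \<and> regs s' 12 = kv i e)
     (6 + (k * (2 + (B * (steps bit_com + 1) + 1 + steps (digit_com T' B \<Delta> R)) + 1) + 1))"
    unfolding kv_def coord_eq[symmetric]
    by (rule runs_key_com[where i = i and off = "n * d"])
       (use s bits T' \<Delta>1 st i e L k_less in \<open>auto simp: E_def\<close>)
  have "runs L (probe_com T' B \<Delta> R) s (\<lambda>s'. mem s' = M1 \<and>
      regs s' 16 = (if M1 (base + kv i e) = 1 then 1 else regs s 16) \<and>
      (\<forall>r. r < 7 \<or> r = 17 \<longrightarrow> regs s' r = regs s r))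
     (6 + (k * (2 + (B * (steps bit_com + 1) + 1 + steps (digit_com T' B \<Delta> R)) + 1) + 1) + 4)"
    unfolding probe_com_def
  proof (rule runs_Seq[OF kc])
    fix s' assume s': "frame s s' \<and> regs s' 12 = kv i e"
    have b: "base + kv i e < 2 ^ L" using key_less(2)[of i e] L(6) by (simp add: base_def)
    have m: "M1 (base + kv i e) \<le> 1" by (simp add: marks_def M0_base)
    have two: "1 < (2::nat) ^ L" using L(8) by (intro one_less_power) auto
    have "wp L (block [Arith 12 Add (Reg 12) (Reg 4), Load 14 (Reg 12),
        If (Eq (Reg 14) (Imm 1)) (Move 16 (Imm 1)) Skip])
       (\<lambda>s'. mem s' = M1 \<and> regs s' 16 = (if M1 (base + kv i e) = 1 then 1 else regs s 16) \<and>
      (\<forall>r. r < 7 \<or> r = 17 \<longrightarrow> regs s' r = regs s r)) s'"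
      using s' s b m two
      by (auto simp: frame_def add.commute[of _ base])
    from wp_runs[OF this]
    show "runs L (block [Arith 12 Add (Reg 12) (Reg 4), Load 14 (Reg 12),
        If (Eq (Reg 14) (Imm 1)) (Move 16 (Imm 1)) Skip]) s'
       (\<lambda>s'. mem s' = M1 \<and> regs s' 16 = (if M1 (base + kv i e) = 1 then 1 else regs s 16) \<and>
      (\<forall>r. r < 7 \<or> r = 17 \<longrightarrow> regs s' r = regs s r)) 4"
      by (simp add: numeral_eq_Suc)
  qed
  then show ?thesis by (rule runs_mono) (auto simp: body_steps_def)
qed

end

context ov_run begin

definition "common (s :: state) \<longleftrightarrow> regs s 0 = n \<and> regs s 1 = d \<and> regs s 2 = k \<and> regs s 3 = E \<and> regs s 4 = base"

lemma runs_ov_com: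
  "runs L (ov_com T T' B \<Delta> R) (ov_input n d u v)
     (\<lambda>s. regs s 0 = (if has_orthogonal_pair n u v then 1 else 0))
     (5 + ((k * (2 + 1) + 1) + ((n * (E * (body_steps T B \<Delta> R k + 2) + 4) + 1)
       + (2 + ((n * (E * (body_steps T' B \<Delta> R k + 2) + 4) + 1) + 1)))))"
proof -
  have two: "1 < (2::nat) ^ L" "2 < (2::nat) ^ L"
    using power_strict_increasing[of 1 L "2::nat"] L(8) by auto
  have nd: "n * d < 2 ^ L" "2 * (n * d) < 2 ^ L" "B < 2 ^ L" "d < 2 ^ L" "\<Delta> < 2 ^ L"
    "B - Suc 0 < 2 ^ L" "d + B - Suc 0 < 2 ^ L"
  proof -
    have "1 * \<Delta> \<le> 2 ^ B * \<Delta>" by (intro mult_right_mono) auto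
    then show "\<Delta> < 2 ^ L" using L(5) by linarith
  qed (use L in linarith)+
  have EL: "E < 2 ^ L" using L(3) by (simp add: E_def)
  define I0 where "I0 = (\<lambda>e (s :: state). regs s 0 = n \<and> regs s 1 = d \<and> regs s 2 = k \<and> regs s 3 = \<Delta> ^ e
     \<and> regs s 4 = base \<and> regs s 5 = 0 \<and> regs s 8 = e \<and> regs s 16 = 0 \<and> regs s 17 = 0 \<and> mem s = M0)"
  define J1 where "J1 = (\<lambda>S (s :: state). common s \<and> regs s 16 = 0 \<and> regs s 17 = 0 \<and> mem s = marks S)"
  \<comment> \<open>Probing leaves the table \<open>M1\<close> unchanged, so register 16 is the
    disjunction of the answers for the pairs in \<open>S\<close>.\<close>
  define J2 where "J2 = (\<lambda>S (s :: state). common s \<and> regs s 17 = n * d \<and> mem s = M1 \<and>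
     regs s 16 = (if \<exists>i e. (i, e) \<in> S \<and> M1 (base + kv i e) = 1 then 1 else 0))"
  let ?P0 = "block [Arith 2 Add (Reg 1) (Imm (B - 1)), Arith 2 Div (Reg 2) (Imm B), Move 3 (Imm 1),
        Arith 4 Mul (Reg 0) (Reg 1), Arith 4 Mul (Imm 2) (Reg 4)]"
  let ?P1 = "While (Less (Reg 8) (Reg 2)) (block [Arith 3 Mul (Reg 3) (Imm \<Delta>), Arith 8 Add (Reg 8) (Imm 1)])"
  let ?P3 = "block [Arith 17 Mul (Reg 0) (Reg 1), Move 5 (Imm 0)]"
  have r0: "runs L ?P0 (ov_input n d u v) (I0 0) 5"
  proof -
    have "wp L ?P0 (I0 0) (ov_input n d u v)"
      using L nd two k_def B1 by (simp add: I0_def M0_def base_def ov_input_def)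
    from wp_runs[OF this] show ?thesis by (simp add: numeral_eq_Suc)
  qed
  have r1: "runs L ?P1 s (I0 k) (k * (2 + 1) + 1)" if "I0 0 s" for s
  proof (rule runs_While)
    fix e s assume e: "e < k" and I0: "I0 e s"
    have "\<Delta> ^ e \<le> \<Delta> ^ k" using e \<Delta>1 by (intro power_increasing) auto
    then have "\<Delta> ^ e < 2 ^ L" using L(3) by linarith
    then have "wp L (block [Arith 3 Mul (Reg 3) (Imm \<Delta>), Arith 8 Add (Reg 8) (Imm 1)]) (I0 (Suc e)) s"
      using I0 e k_less nd two by (simp add: I0_def mult.commute)
    from wp_runs[OF this]
    show "test_val (Less (Reg 8) (Reg 2)) s \<and> test_fits L (Less (Reg 8) (Reg 2)) s \<and>
        runs L (block [Arith 3 Mul (Reg 3) (Imm \<Delta>), Arith 8 Add (Reg 8) (Imm 1)]) s (I0 (Suc e)) 2"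
      using I0 e k_less by (simp add: I0_def numeral_eq_Suc)
  qed (use that k_less in \<open>auto simp: I0_def\<close>)
  have r2: "runs L (sweep (mark_com T B \<Delta> R)) s (J1 ({..<n} \<times> {..<E}))
      (n * (E * (body_steps T B \<Delta> R k + 2) + 4) + 1)" if "I0 k s" for s
  proof (rule runs_sweep)
    fix S s i e assume "i < n" "e < E" "J1 S s" "regs s 5 = i" "regs s 6 = e"
    then show "runs L (mark_com T B \<Delta> R) s
        (\<lambda>s'. J1 (insert (i, e) S) s' \<and> regs s' 5 = i \<and> regs s' 6 = e) (body_steps T B \<Delta> R k)"
      by (intro runs_mono[OF runs_mark[of i e s S]]) (auto simp: J1_def common_def)
  qed (use that L EL in \<open>auto simp: J1_def common_def I0_def E_def marks_def[abs_def]\<close>)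
  have r3: "runs L ?P3 s (\<lambda>s. J2 {} s \<and> regs s 5 = 0) 2" if "J1 ({..<n} \<times> {..<E}) s" for s
  proof -
    have "wp L ?P3 (\<lambda>s. J2 {} s \<and> regs s 5 = 0) s"
      using that L nd two by (simp add: J1_def J2_def common_def)
    from wp_runs[OF this] show ?thesis by (simp add: numeral_eq_Suc)
  qed
  have r4: "runs L (sweep (probe_com T' B \<Delta> R)) s (J2 ({..<n} \<times> {..<E}))
      (n * (E * (body_steps T' B \<Delta> R k + 2) + 4) + 1)" if "J2 {} s \<and> regs s 5 = 0" for s
  proof (rule runs_sweep)
    fix S s i e assume "i < n" "e < E" "J2 S s" "regs s 5 = i" "regs s 6 = e"
    then show "runs L (probe_com T' B \<Delta> R) s
        (\<lambda>s'. J2 (insert (i, e) S) s' \<and> regs s' 5 = i \<and> regs s' 6 = e) (body_steps T' B \<Delta> R k)"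
      by (intro runs_mono[OF runs_probe[of i e s]]) (auto simp: J2_def common_def)
  qed (use that L EL in \<open>auto simp: J2_def common_def\<close>)
  have r5: "runs L (Move 0 (Reg 16)) s
      (\<lambda>s. regs s 0 = (if has_orthogonal_pair n u v then 1 else 0)) 1"
    if "J2 ({..<n} \<times> {..<E}) s" for s
  proof -
    have "regs s 16 = (if has_orthogonal_pair n u v then 1 else 0)"
      using that unfolding J2_def has_orthogonal_pair_iff by blast
    then have "wp L (Move 0 (Reg 16)) (\<lambda>s. regs s 0 = (if has_orthogonal_pair n u v then 1 else 0)) s"
      using two by simp
    from wp_runs[OF this] show ?thesis by simp
  qed
  show ?thesis
    unfolding ov_com_def
    by (rule runs_Seq[OF r0], rule runs_Seq[OF r1], assumption, rule runs_Seq[OF r2], assumption,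
        rule runs_Seq[OF r3], assumption, rule runs_Seq[OF r4], assumption, rule r5)
qed

end

section \<open>Running time\<close>

text \<open>For constant \<open>R\<close>, \<Delta> and \<open>B\<close> the crude estimate
  \<open>x ^ k \<le> 2 ^ (x * D)\<close> is good enough: the word length only has to be linear in
  \<open>d\<close> plus the bit length of \<open>n\<close>.\<close>

lemma word_length_bounds:
  fixes n d B \<Delta> R :: nat
  defines "k \<equiv> (d + (B - 1)) div B"
    and "L \<equiv> floorlog 2 n + (R + \<Delta> + B + 9) * (d + B + 1)"
  assumes n: "1 \<le> n"
  shows "n < 2 ^ L" "d + B < 2 ^ L" "\<Delta> ^ k < 2 ^ L" "2 * (n * d) + k * B + B < 2 ^ L"
    "2 ^ B * \<Delta> < 2 ^ L" "2 * (n * d) + R ^ k < 2 ^ L" "R < 2 ^ L" "2 \<le> L"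
proof -
  define D where "D = d + B + 1"
  define N :: nat where "N = 2 ^ floorlog 2 n"
  have N: "n < N" using n floorlog_bounds[of n 2] by (simp add: N_def)
  have L: "L = floorlog 2 n + (R * D + \<Delta> * D + B * D + 9 * D)"
    by (simp add: L_def D_def algebra_simps)
  have D1: "1 \<le> D" by (simp add: D_def)
  have le: "R \<le> R * D" "\<Delta> \<le> \<Delta> * D" "B \<le> B * D" using D1 by simp_all
  have pow: "x < 2 ^ L" if "x \<le> N * 2 ^ m" "m < R * D + \<Delta> * D + B * D + 9 * D" for x m :: nat
  proof -
    have "N * 2 ^ m = 2 ^ (floorlog 2 n + m)" by (simp add: N_def power_add)
    also have "\<dots> < 2 ^ L" using that(2) unfolding L by (intro power_strict_increasing) auto
    finally show ?thesis using that(1) by linarith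
  qed
  have N1: "1 \<le> N" using N by simp
  have pow1: "x < 2 ^ L" if "x \<le> 2 ^ m" "m < R * D + \<Delta> * D + B * D + 9 * D" for x m :: nat
    using pow[OF _ that(2), of x] that(1) mult_le_mono1[OF N1, of "2 ^ m"] by simp
  have kD: "k \<le> D" unfolding k_def D_def using div_le_dividend[of "d + (B - 1)" B] by linarith
  have kB: "k * B \<le> d + B" unfolding k_def using div_times_less_eq_dividend[of "d + (B - 1)" B] by linarith
  have powk: "x ^ k \<le> 2 ^ (x * D)" for x :: nat
  proof -
    have "x ^ k \<le> (2 ^ x) ^ k" using less_exp[of x] by (intro power_mono) auto
    also have "\<dots> = 2 ^ (x * k)" by (simp add: power_mult)
    also have "\<dots> \<le> 2 ^ (x * D)" using kD by (intro power_increasing) auto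
    finally show ?thesis .
  qed
  show "n < 2 ^ L" using N D1 by (intro pow[of _ 0]) auto
  show "d + B < 2 ^ L"
    using less_exp[of "d + B"] by (intro pow1[of _ "d + B"]) (auto simp: D_def)
  show "\<Delta> ^ k < 2 ^ L" using D1 by (intro pow1[OF powk]) auto
  show "2 * (n * d) + k * B + B < 2 ^ L"
  proof (rule pow[of _ "D + 2"])
    have "k * B + B \<le> 1 * (2 * D)" using kB by (simp add: D_def)
    also have "\<dots> \<le> N * (2 * D)" using N1 by (intro mult_right_mono) auto
    finally have "2 * (n * d) + k * B + B \<le> 2 * (N * D) + N * (2 * D)"
      using mult_mono[of n N d D] N by (simp add: D_def)
    also have "\<dots> = N * (4 * D)" by simp
    also have "\<dots> \<le> N * (4 * 2 ^ D)" using less_exp[of D] by (intro mult_left_mono) auto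
    finally show "2 * (n * d) + k * B + B \<le> N * 2 ^ (D + 2)" by simp
  qed (use D1 in auto)
  show "2 ^ B * \<Delta> < 2 ^ L"
  proof (rule pow1[of _ "B + \<Delta>"])
    show "2 ^ B * \<Delta> \<le> 2 ^ (B + \<Delta>)" using less_exp[of \<Delta>] by (simp add: power_add)
  qed (use le D1 in linarith)
  show "2 * (n * d) + R ^ k < 2 ^ L"
  proof (rule pow[of _ "D + 1 + R * D + 1"])
    have "2 * (n * d) \<le> N * 2 ^ (D + 1)"
    proof -
      have "n * d \<le> N * 2 ^ D" using N less_exp[of D] by (intro mult_mono) (auto simp: D_def)
      then show ?thesis by simp
    qed
    moreover have "R ^ k \<le> N * 2 ^ (R * D)"
      using mult_mono[OF N1 powk[of R]] by simp
    moreover have "N * 2 ^ (D + 1) \<le> N * 2 ^ (D + 1 + R * D)" "N * 2 ^ (R * D) \<le> N * 2 ^ (D + 1 + R * D)"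
      by (intro mult_left_mono power_increasing; simp)+
    ultimately have "2 * (n * d) + R ^ k \<le> N * 2 ^ (D + 1 + R * D) + N * 2 ^ (D + 1 + R * D)"
      by linarith
    then show "2 * (n * d) + R ^ k \<le> N * 2 ^ (D + 1 + R * D + 1)" by simp
  qed (use D1 in auto)
  show "R < 2 ^ L"
  proof (rule pow1[of _ R])
    show "R < R * D + \<Delta> * D + B * D + 9 * D" using le D1 by linarith
  qed (simp add: less_imp_le)
  show "2 \<le> L" using D1 by (simp add: L)
qed

text \<open>Costs outside the inner loops are absorbed because \<open>n * E\<close> is at least 1
  and at least \<open>n\<close>; the constants add up to 47 = 11 + 8 + 28.\<close>

lemma step_count_bound:
  fixes n E k a b :: nat
  assumes "1 \<le> n" "1 \<le> E"
  shows "5 + ((k * (2 + 1) + 1) + ((n * (E * (12 + k * a + 2) + 4) + 1)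
       + (2 + ((n * (E * (12 + k * b + 2) + 4) + 1) + 1))))
    \<le> n * E * (k + 1) * (47 + a + b)"
proof -
  have nE: "1 \<le> n * E" "n \<le> n * E" using assms by simp_all
  have "5 + ((k * (2 + 1) + 1) + ((n * (E * (12 + k * a + 2) + 4) + 1)
       + (2 + ((n * (E * (12 + k * b + 2) + 4) + 1) + 1))))
    = 1 * (11 + 3 * k) + n * 8 + n * E * (28 + k * (a + b))"
    by (simp add: algebra_simps)
  also have "\<dots> \<le> n * E * (11 + 3 * k) + n * E * 8 + n * E * (28 + k * (a + b))"
    by (intro add_mono mult_right_mono nE order_refl) simp_all
  also have "\<dots> = n * E * (47 + k * (3 + a + b))" by (simp add: algebra_simps)
  also have "\<dots> \<le> n * E * ((k + 1) * (47 + a + b))" by (intro mult_left_mono) (simp_all add: algebra_simps)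
  finally show ?thesis by (simp only: mult.assoc)
qed

theorem theorem1p3:
  "\<exists>(c::com) (C::real) (k::nat).
     solves_OV_in_time c
       (\<lambda>n d. C * (real n * 1.155 ^ d) * (1 + real d + log 2 (real n)) ^ k)"
proof -
  obtain B \<Delta> R :: nat and T T' :: "nat \<Rightarrow> nat \<Rightarrow> nat" where
    B1: "1 \<le> B" and \<Delta>1: "1 \<le> \<Delta>" and \<Delta>: "real \<Delta> \<le> 1.155 ^ B" and
    T: "\<And>w g. T w g < R" and T': "\<And>w g. T' w g < R" and
    tables: "\<And>\<beta> \<gamma>. (\<And>j. j < B \<Longrightarrow> \<beta> j < 2) \<Longrightarrow> (\<And>j. j < B \<Longrightarrow> \<gamma> j < 2) \<Longrightarrow>
       (\<exists>g<\<Delta>. \<exists>g'<\<Delta>. T (horner 2 \<beta> B) g = T' (horner 2 \<gamma> B) g')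
         \<longleftrightarrow> (\<forall>j<B. \<beta> j = 0 \<or> \<gamma> j = 0)"
    by (rule block_tables) blast
  define a where "a = 2 + (B * (steps bit_com + 1) + 1 + steps (digit_com T B \<Delta> R)) + 1"
  define b where "b = 2 + (B * (steps bit_com + 1) + 1 + steps (digit_com T' B \<Delta> R)) + 1"
  define W where "W = R + \<Delta> + B + 9"
  \<comment> \<open>\<open>1.155 ^ B\<close> pays for rounding \<open>d\<close> up to whole blocks,
    \<open>B + 1\<close> for expressing the number of blocks by the polynomial factor, and the last
    factor does the same for the word length.\<close>
  define C where "C = 1.155 ^ B * real (B + 1) * real (47 + a + b) * real (2 * (W * (B + 1) + 1) + 1)"
  have body: "body_steps T B \<Delta> R k = 12 + k * a" "body_steps T' B \<Delta> R k = 12 + k * b" for k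
    by (simp_all add: body_steps_def a_def b_def)
  \<comment> \<open>The exponent 2 stands for one factor from the number of blocks and one from the
    word length.\<close>
  have "solves_OV_in_time (ov_com T T' B \<Delta> R)
      (\<lambda>n d. C * (real n * 1.155 ^ d) * (1 + real d + log 2 (real n)) ^ 2)"
    unfolding solves_OV_in_time_def
  proof (intro allI impI)
    fix n d u v assume "1 \<le> n \<and> ov_instance n d u v"
    then have n: "1 \<le> n" and inst: "ov_instance n d u v" by auto
    define k where "k = (d + (B - 1)) div B"
    define F where "F = \<Delta> ^ k"
    define L where "L = floorlog 2 n + W * (d + B + 1)"
    define X where "X = 1 + real d + log 2 (real n)"
    interpret ov: ov_run T T' B \<Delta> R n d L u v k
      unfolding k_def L_def W_def
      by (rule ov_run.intro; (rule T T' B1 \<Delta>1 inst word_length_bounds[OF n] | rule tables; assumption))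
    obtain t s where ex: "exec (ov_com T T' B \<Delta> R) (ov_input n d u v) t s"
      and ans: "regs s 0 = (if has_orthogonal_pair n u v then 1 else 0)"
      and t: "t \<le> (5 + ((k * (2 + 1) + 1) + ((n * (F * (12 + k * a + 2) + 4) + 1)
       + (2 + ((n * (F * (12 + k * b + 2) + 4) + 1) + 1))))) * (2 * L + 1)"
      using ov.runs_ov_com unfolding runs_def body ov.E_def F_def[symmetric] by blast
    have logn: "0 \<le> log 2 (real n)" using n by simp
    have X1: "1 \<le> X" "real d \<le> X" using logn by (auto simp: X_def)
    have F1: "1 \<le> F" using \<Delta>1 by (simp add: F_def)
    have "t \<le> n * F * (k + 1) * (47 + a + b) * (2 * L + 1)"
      using t step_count_bound[OF n F1, of k a b] by (meson mult_le_mono1 order_trans)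
    then have "real t \<le> real (n * F * (k + 1) * (47 + a + b) * (2 * L + 1))" by (rule of_nat_mono)
    also have "\<dots> = real n * real F * real (k + 1) * real (47 + a + b) * real (2 * L + 1)"
      by (simp only: of_nat_mult)
    also have "\<dots> \<le> real n * (1.155 ^ d * 1.155 ^ B) * (real (B + 1) * X) * real (47 + a + b)
        * (real (2 * (W * (B + 1) + 1) + 1) * X)"
    proof (intro mult_mono order_refl)
      have "real F \<le> (1.155 ^ B) ^ k" unfolding F_def of_nat_power using \<Delta> by (intro power_mono) auto
      also have "\<dots> = 1.155 ^ (k * B)" by (simp add: power_mult mult.commute)
      also have "\<dots> \<le> 1.155 ^ (d + B)"
      proof (rule power_increasing)
        show "k * B \<le> d + B"
          unfolding k_def using div_times_less_eq_dividend[of "d + (B - 1)" B] by linarith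
      qed simp
      finally show "real F \<le> 1.155 ^ d * 1.155 ^ B" by (simp add: power_add)
      have DX: "real (d + B + 1) \<le> real (B + 1) * X"
      proof -
        have "real B * 1 \<le> real B * X" using X1 by (intro mult_left_mono) auto
        then show ?thesis using logn by (simp add: X_def algebra_simps)
      qed
      have "k \<le> d + B" unfolding k_def using div_le_dividend[of "d + (B - 1)" B] by linarith
      then have "real (k + 1) \<le> real (d + B + 1)" by simp
      also note DX
      finally show "real (k + 1) \<le> real (B + 1) * X" .
      have "real (floorlog 2 n) \<le> 1 + log 2 (real n)"
        using n logn by (simp add: floorlog_def)
      then have fl: "real (floorlog 2 n) \<le> X" by (simp add: X_def)
      have "real (2 * L + 1) = 2 * (real (floorlog 2 n) + real W * real (d + B + 1)) + 1"
        unfolding L_def by (simp only: of_nat_add of_nat_mult of_nat_numeral of_nat_1)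
      also have "\<dots> \<le> 2 * (X + real W * (real (B + 1) * X)) + X"
        using fl DX X1 by (intro add_mono mult_left_mono) auto
      also have "\<dots> = real (2 * (W * (B + 1) + 1) + 1) * X" by (simp add: algebra_simps)
      finally show "real (2 * L + 1) \<le> real (2 * (W * (B + 1) + 1) + 1) * X" .
    qed (use X1 in auto)
    also have "\<dots> = C * (real n * 1.155 ^ d) * X ^ 2"
      unfolding C_def power2_eq_square by (simp only: mult_ac)
    finally have "real t \<le> C * (real n * 1.155 ^ d) * X ^ 2" .
    then show "\<exists>t s. exec (ov_com T T' B \<Delta> R) (ov_input n d u v) t s \<and>
           regs s 0 = (if has_orthogonal_pair n u v then 1 else 0) \<and>
           real t \<le> C * (real n * 1.155 ^ d) * (1 + real d + log 2 (real n)) ^ 2"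
      using ex ans unfolding X_def by blast
  qed
  then show ?thesis by blast
qed

end
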